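(* Let $\mathfrak{q}=(q_i)_{i\ge 0}$ be a gap sequence such that, for some $q\ge 0$ and $0\le\beta<1$, $Q_k=\sum_{i=0}^{k-1}q_i=qk+O(k^\beta)$ as $k\to\infty$. Let $(k_n)$ be a sequence of positive integers with $k_n\to\infty$ and $k_n/\sqrt n\to\tau$ as $n\to\infty$, for some $\tau\in(0,\sqrt{2/q})$ (the right bound being understood as $+\infty$ when $q=0$). Let $T_*=T_*(\tau;q)>0$ be the (unique) solution of the equation $\tau\,\vartheta_q(T_* )=T_*$, and put $z_n:=T_*/k_n\sim T_*/(\tau\sqrt n)$. Then, for every $t_0>0$ and any $\varepsilon>0$, $$\limsup_{n\to\infty}\frac1{\sqrt n}\log\nu^{\mathfrak{q}}_{n,k_n}\Bigl\{\lambda\in\Lambda_{\mathfrak{q}}(n,k_n)\colon \sup_{t\ge t_0}\bigl|z_nY_\lambda(t/z_n)-\varphi_{T_*}(t;q)\bigr|>\varepsilon\Bigr\}<0 .$$ Furthermore, if $q=0$ then the same result is also valid in the case $k_n/\sqrt n\to\infty$, under the additional condition $\limsup_{n\to\infty}k_n^{\beta+1}/n^{1-\delta}<\infty$ for some $\delta\in(0,1)$, with $T_*=\infty$, $\vartheta_0(\infty)=\pi/\sqrt6$ and $z_n=\vartheta_0(\infty)/\sqrt n=\pi/\sqrt{6n}$.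
   Context: A partition is a sequence of integers $\lambda_1\ge\lambda_2\ge\dots\ge0$ with finitely many nonzero terms; $N(\lambda)=\sum_i\lambda_i$ is its weight and $K(\lambda)=\#\{i:\lambda_i>0\}$ its length. A gap sequence $\mathfrak{q}=(q_i)_{i\ge0}$ is a sequence of non-negative integers with $q_0\ge1$. $\Lambda_{\mathfrak{q}}$ is the set of all partitions $\lambda$ such that, with $k=K(\lambda)$, $\lambda_i-\lambda_{i+1}\ge q_{k-i}$ for $i=1,\dots,k$ (the empty partition is included). $\Lambda_{\mathfrak{q}}(n,k)=\{\lambda\in\Lambda_{\mathfrak{q}}: N(\lambda)=n,\ K(\lambda)=k\}$ and $\nu^{\mathfrak{q}}_{n,k}$ is the uniform probability measure on $\Lambda_{\mathfrak{q}}(n,k)$ (defined whenever this set is non-empty). $Y_\lambda(t)=\lambda_{\lfloor t\rfloor+1}$ for $t\ge0$. Convention: $\log0=-\infty$. $\mathrm{Li}_2(x)=\sum_{k\ge1}x^k/k^2$ for $0\le x\le1$, and $\vartheta_q(t)=\sqrt{\tfrac12 qt^2+\mathrm{Li}_2(1-e^{-t})}$ for $t>0$. For $0<T<\infty$, $\varphi_T(t;q)=q(T-t)+\log\frac{1-e^{-T}}{1-e^{-t}}$ for $0<t\le T$ and $\varphi_T(t;q)=0$ for $t\ge T$; also $\varphi_\infty(t;0)=-\log(1-e^{-t})$ for $t>0$. *)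

theory Defs
  imports "HOL-Probability.Probability" "HOL-Library.Landau_Symbols"
begin

text \<open>Partitions are indexed from 0: the value \<open>lam i\<close> is the part written
  \<open>\<lambda>\<^sub>i\<^sub>+\<^sub>1\<close> in the usual notation.\<close>

definition is_partition :: "(nat \<Rightarrow> nat) \<Rightarrow> bool" where
  "is_partition lam \<longleftrightarrow> antimono lam \<and> finite {i. lam i > 0}"

definition weight :: "(nat \<Rightarrow> nat) \<Rightarrow> nat" where
  "weight lam = (\<Sum>i | lam i > 0. lam i)"

definition num_parts :: "(nat \<Rightarrow> nat) \<Rightarrow> nat" where
  "num_parts lam = card {i. lam i > 0}"

definition gap_sequence :: "(nat \<Rightarrow> nat) \<Rightarrow> bool" where
  "gap_sequence qs \<longleftrightarrow> qs 0 \<ge> 1"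

text \<open>With \<open>k = num_parts lam\<close>, the condition \<open>\<lambda>\<^sub>j - \<lambda>\<^sub>j\<^sub>+\<^sub>1 \<ge> q\<^sub>k\<^sub>-\<^sub>j\<close> for \<open>1 \<le> j \<le> k\<close> is
  stated for \<open>j = Suc i\<close>, and additively to avoid truncated subtraction of parts.\<close>

definition gap_partitions :: "(nat \<Rightarrow> nat) \<Rightarrow> (nat \<Rightarrow> nat) set" where
  "gap_partitions qs = {lam. is_partition lam \<and>
     (\<forall>i < num_parts lam. lam (Suc i) + qs (num_parts lam - Suc i) \<le> lam i)}"

definition gap_partitions_of :: "(nat \<Rightarrow> nat) \<Rightarrow> nat \<Rightarrow> nat \<Rightarrow> (nat \<Rightarrow> nat) set" where
  "gap_partitions_of qs n k =
     {lam \<in> gap_partitions qs. weight lam = n \<and> num_parts lam = k}"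

text \<open>Only meaningful if \<open>gap_partitions_of qs n k\<close> is non-empty (it is always finite);
  otherwise \<^const>\<open>pmf_of_set\<close> is unspecified.\<close>

definition gap_uniform :: "(nat \<Rightarrow> nat) \<Rightarrow> nat \<Rightarrow> nat \<Rightarrow> (nat \<Rightarrow> nat) pmf" where
  "gap_uniform qs n k = pmf_of_set (gap_partitions_of qs n k)"

definition young_boundary :: "(nat \<Rightarrow> nat) \<Rightarrow> real \<Rightarrow> real" where
  "young_boundary lam t = real (lam (nat \<lfloor>t\<rfloor>))"

definition Li2 :: "real \<Rightarrow> real" where
  "Li2 x = (\<Sum>k. x ^ Suc k / (real (Suc k))\<^sup>2)"

definition vartheta :: "real \<Rightarrow> real \<Rightarrow> real" where
  "vartheta q t = sqrt (q * t\<^sup>2 / 2 + Li2 (1 - exp (- t)))"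

definition limit_shape :: "real \<Rightarrow> real \<Rightarrow> real \<Rightarrow> real" where
  "limit_shape q T t =
     (if t \<le> T then q * (T - t) + ln ((1 - exp (- T)) / (1 - exp (- t))) else 0)"

text \<open>The shape for \<open>T = \<infinity>\<close>, which is only used with \<open>q = 0\<close>.\<close>

definition limit_shape_inf :: "real \<Rightarrow> real" where
  "limit_shape_inf t = - ln (1 - exp (- t))"

text \<open>Logarithm of a probability, with \<open>log 0 = -\<infinity>\<close>.\<close>

definition log_prob :: "real \<Rightarrow> ereal" where
  "log_prob p = (if p = 0 then - \<infinity> else ereal (ln p))"

text \<open>The supremum is taken in \<^typ>\<open>ereal\<close>, so that no boundedness assumption is implicit.\<close>

definition deviation_event ::
  "(nat \<Rightarrow> nat) \<Rightarrow> nat \<Rightarrow> nat \<Rightarrow> real \<Rightarrow> (real \<Rightarrow> real) \<Rightarrow> real \<Rightarrow> real \<Rightarrow> (nat \<Rightarrow> nat) set" where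
  "deviation_event qs n k z \<phi> t0 \<epsilon> = {lam \<in> gap_partitions_of qs n k.
     (SUP t\<in>{t0..}. ereal \<bar>z * young_boundary lam (t / z) - \<phi> t\<bar>) > ereal \<epsilon>}"

end

theory Submission
  imports Defs
begin

text \<open>
  Subtract from the differences of consecutive parts their prescribed minima. The remaining
  excesses \<open>D j\<close> are arbitrary natural numbers, so the uniform measure on gap partitions of \<open>n\<close>
  with \<open>k\<close> parts becomes the uniform measure on vectors \<open>D\<close> with \<open>\<Sum>j<k. Suc j * D j = m\<close>,
  where \<open>m\<close> is \<open>n\<close> minus the weight of the minimal partition (\<open>bij_betw_partition_of\<close>). The height of
  the partition at \<open>i\<close> is the tail sum of \<open>D\<close> from \<open>i\<close> on plus a deterministic sum of gaps, which
  produces the linear term \<open>q * (T - t)\<close> of the limit shape.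

  If \<open>D\<close> is weighted by \<open>exp (- w * weight)\<close>, its coordinates behave like independent geometric
  variables with means \<open>bose (w * Suc j)\<close>. Tail sums are then Riemann sums of \<open>bose\<close>, whose
  antiderivative is minus \<open>limit_shape_inf\<close>, and the mean weight is a Riemann sum of \<open>u * bose u\<close>,
  whose antiderivative is the dilogarithm \<open>dilog_exp\<close>. Equating the mean weight with \<open>m\<close> gives
  the equation for \<open>T\<close>. Exponential tilting of the tail sum bounds the weighted
  number of vectors with a wrong tail sum (\<open>card_configs_tail_le\<close>).

  To compare with the uniform measure, a matching lower bound on the number of vectors of weight
  exactly \<open>m\<close> is needed, up to a factor \<open>exp (\<eta> / z)\<close> with arbitrarily small \<open>\<eta>\<close>. Here
  \<open>1 / z\<close> is of order \<open>sqrt n\<close>. The number of vectors increases with the weight,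
  so it is enough that a tilt slightly stronger than the critical one puts a quarter of its mass
  on weights slightly below \<open>m\<close> (\<open>card_configs_lower_bound\<close>,
  \<open>card_configs_asymptotic_lower_bound\<close>). This again follows from tilting and from the convexity
  of the logarithm of the generating function.

  Together these bounds make a deviation at one fixed \<open>t\<close> exponentially rare
  (\<open>one_sided_tail_deviation_rare\<close>). Monotonicity of the boundary and continuity of the limit
  shape reduce the supremum over \<open>t\<close> to finitely many points (\<open>monotone_uniform_grid\<close>).
  The lengths of order \<open>sqrt n\<close> and the longer ones differ only in the limits of
  \<open>dilog_exp\<close> and \<open>limit_shape_inf\<close> at multiples of \<open>z n * k n\<close>, so the argument is carried out once for
  abstract limits (\<open>tilted_scaling\<close>).
\<close>

section \<open>The dilogarithm and the shape function\<close>

text \<open>Termwise differentiation turns the series into that of \<open>- ln (1 - x)\<close>.\<close>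

lemma Li2_has_derivative:
  assumes "0 < x" "x < 1"
  shows "(Li2 has_real_derivative (- ln (1 - x) / x)) (at x)"
proof -
  have summ: "summable (\<lambda>n. 1 / (real (Suc n))\<^sup>2 * real (Suc n) * y ^ n)"
    if "y \<in> {-1<..<1}" for y :: real
  proof (rule summable_comparison_test')
    show "summable (\<lambda>n. \<bar>y\<bar> ^ n)" using that by (intro summable_geometric) auto
    show "norm (1 / (real (Suc n))\<^sup>2 * real (Suc n) * y ^ n) \<le> \<bar>y\<bar> ^ n" for n
      by (simp add: power2_eq_square abs_mult power_abs divide_simps mult_le_cancel_left1)
  qed
  have "DERIV (\<lambda>x. \<Sum>n. 1 / (real (Suc n))\<^sup>2 * x ^ Suc n) x
      :> (\<Sum>n. 1 / (real (Suc n))\<^sup>2 * real (Suc n) * x ^ n)"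
    by (rule DERIV_power_series'[where R = 1]) (use summ assms in auto)
  moreover have "(\<lambda>x. \<Sum>n. 1 / (real (Suc n))\<^sup>2 * x ^ Suc n) = Li2"
    by (simp add: Li2_def fun_eq_iff)
  moreover have "(\<Sum>n. 1 / (real (Suc n))\<^sup>2 * real (Suc n) * x ^ n) = - ln (1 - x) / x"
  proof -
    have s: "summable (\<lambda>n. 1 / (real (Suc n))\<^sup>2 * real (Suc n) * x ^ n)"
      using summ assms by auto
    have "ln (1 - x) = (\<Sum>n. (-1)^n * (1 / real (n + 1)) * ((1 - x) - 1)^(Suc n))"
      using assms by (intro ln_series) auto
    also have "\<dots> = (\<Sum>n. - x * (1 / (real (Suc n))\<^sup>2 * real (Suc n) * x ^ n))"
    proof (rule suminf_cong)
      fix n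
      have "(-1)^n * ((1 - x) - 1)^(Suc n) = - x * ((-1) ^ n * (- x) ^ n)" by simp
      also have "(-1) ^ n * (- x) ^ n = x ^ n" by (metis minus_mult_minus mult_1 power_mult_distrib)
      finally have "(-1)^n * ((1 - x) - 1)^(Suc n) = - x * x ^ n" .
      then show "(-1)^n * (1 / real (n + 1)) * ((1 - x) - 1)^(Suc n)
          = - x * (1 / (real (Suc n))\<^sup>2 * real (Suc n) * x ^ n)"
        by (simp add: power2_eq_square divide_simps)
    qed
    also have "\<dots> = - x * (\<Sum>n. 1 / (real (Suc n))\<^sup>2 * real (Suc n) * x ^ n)"
      by (rule suminf_mult[OF s])
    finally show ?thesis using assms by (simp add: field_simps)
  qed
  ultimately show ?thesis by simp
qed

lemma summable_inverse_squares: "summable (\<lambda>k. 1 / (real (Suc k))\<^sup>2)"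
  using inverse_squares_sums by (auto simp: sums_iff add.commute)

lemma Li2_0: "Li2 0 = 0"
  by (simp add: Li2_def)

lemma Li2_1: "Li2 1 = pi\<^sup>2 / 6"
  using inverse_squares_sums by (simp add: Li2_def sums_iff add.commute)

text \<open>Continuity up to \<open>1\<close>, where the power series no longer converges geometrically, comes from
  the summable majorant \<open>1 / k\<^sup>2\<close>. It is what gives the value \<open>pi\<^sup>2 / 6\<close> as the limit of
  \<open>dilog_exp\<close> at infinity.\<close>

lemma continuous_on_Li2: "continuous_on {0..1} Li2"
proof -
  have "uniform_limit {0..1} (\<lambda>n x. \<Sum>k<n. x ^ Suc k / (real (Suc k))\<^sup>2)
      (\<lambda>x. \<Sum>k. x ^ Suc k / (real (Suc k))\<^sup>2) sequentially"
  proof (rule Weierstrass_m_test)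
    show "norm (x ^ Suc k / (real (Suc k))\<^sup>2) \<le> 1 / (real (Suc k))\<^sup>2"
      if "x \<in> {0..1}" for k and x :: real
      using that by (auto simp: abs_mult power_abs intro!: divide_right_mono power_le_one
          simp del: power_Suc)
  qed (rule summable_inverse_squares)
  then have "continuous_on {0..1} (\<lambda>x::real. \<Sum>k. x ^ Suc k / (real (Suc k))\<^sup>2)"
    by (rule uniform_limit_theorem[rotated])
      (auto intro!: always_eventually continuous_intros)
  then show ?thesis by (simp add: Li2_def[abs_def])
qed

text \<open>The mean of a geometric variable with ratio \<open>exp (- u)\<close>, and minus the derivative of
  \<open>limit_shape_inf\<close>.\<close>

definition bose :: "real \<Rightarrow> real" where
  "bose u = 1 / (exp u - 1)"

text \<open>In this parametrisation the dilogarithm is an antiderivative of \<open>u * bose u\<close>, the integral from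
  \<open>0\<close> to \<open>u\<close>. It describes the mean weight of the tilted model.\<close>

definition dilog_exp :: "real \<Rightarrow> real" where
  "dilog_exp u = Li2 (1 - exp (- u))"

lemma bose_pos: "0 < u \<Longrightarrow> 0 < bose u"
  by (simp add: bose_def)

lemma bose_antimono: "0 < u \<Longrightarrow> u \<le> v \<Longrightarrow> bose v \<le> bose u"
  by (auto simp: bose_def intro!: divide_left_mono mult_pos_pos)

lemma bose_times_le_1: "0 < u \<Longrightarrow> u * bose u \<le> 1"
  using exp_ge_add_one_self[of u] by (simp add: bose_def divide_simps del: exp_ge_add_one_self)

lemma times_bose_antimono:
  assumes "0 < u" "u \<le> v"
  shows "v * bose v \<le> u * bose u"
proof (rule DERIV_nonpos_imp_nonincreasing[OF assms(2)])
  fix x assume x: "u \<le> x" "x \<le> v"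
  then have x0: "0 < x" using assms by simp
  have "((\<lambda>x. x * (1 / (exp x - 1))) has_real_derivative
       1 / (exp x - 1) + x * (- exp x / (exp x - 1)\<^sup>2)) (at x)"
    using x0 by (auto intro!: derivative_eq_intros simp: power2_eq_square) (simp add: divide_simps)
  moreover have "1 / (exp x - 1) + x * (- exp x / (exp x - 1)\<^sup>2) \<le> 0"
  proof -
    have "1 - x \<le> exp (- x)" using exp_ge_add_one_self[of "-x"] by simp
    then have "(1 - x) * exp x \<le> exp (- x) * exp x" by (intro mult_right_mono) auto
    then have "exp x - 1 \<le> x * exp x" by (simp add: algebra_simps flip: exp_add)
    moreover have "exp x - 1 > 0" using x0 by simp
    ultimately show ?thesis by (simp add: divide_simps power2_eq_square)
  qed
  ultimately show "\<exists>y. ((\<lambda>u. u * bose u) has_real_derivative y) (at x) \<and> y \<le> 0"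
    unfolding bose_def by blast
qed

lemma shape_has_derivative:
  assumes "0 < u"
  shows "(limit_shape_inf has_real_derivative - bose u) (at u)"
proof -
  have "((\<lambda>t. - ln (1 - exp (- t))) has_real_derivative - (exp (-u) / (1 - exp (-u)))) (at u)"
    using assms by (auto intro!: derivative_eq_intros)
  moreover have "exp (-u) / (1 - exp (-u)) = bose u"
    using assms by (simp add: bose_def exp_minus field_simps)
  ultimately show ?thesis by (simp add: limit_shape_inf_def[abs_def])
qed

text \<open>By the mean value theorem and the monotonicity of the derivative, an increment lies between the
  end values of the derivative times the step. The same two inequalities serve as one term of
  a Riemann sum and as a tangent inequality of a convex function.\<close>

lemma shape_increment:
  assumes "0 < u" "u \<le> v"
  shows "(v - u) * bose v \<le> limit_shape_inf u - limit_shape_inf v"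
    and "limit_shape_inf u - limit_shape_inf v \<le> (v - u) * bose u"
proof -
  have "(v - u) * bose v \<le> limit_shape_inf u - limit_shape_inf v
      \<and> limit_shape_inf u - limit_shape_inf v \<le> (v - u) * bose u"
  proof (cases "u = v")
    case False
    then obtain w where w: "u < w" "w < v"
      "limit_shape_inf v - limit_shape_inf u = (v - u) * (- bose w)"
      using assms MVT2[of u v limit_shape_inf "\<lambda>w. - bose w"] shape_has_derivative by force
    have "bose v \<le> bose w" "bose w \<le> bose u" using w assms by (auto intro!: bose_antimono)
    then have "(v - u) * bose v \<le> (v - u) * bose w" "(v - u) * bose w \<le> (v - u) * bose u"
      using assms by (auto intro!: mult_left_mono)
    then show ?thesis using w by (simp add: algebra_simps)
  qed simp
  then show "(v - u) * bose v \<le> limit_shape_inf u - limit_shape_inf v"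
    and "limit_shape_inf u - limit_shape_inf v \<le> (v - u) * bose u" by auto
qed

lemma shape_antimono: "0 < u \<Longrightarrow> u \<le> v \<Longrightarrow> limit_shape_inf v \<le> limit_shape_inf u"
  using shape_increment(1)[of u v] bose_pos[of v]
  by (smt (verit) mult_nonneg_nonneg)

lemma shape_pos: "0 < u \<Longrightarrow> 0 < limit_shape_inf u"
  by (simp add: limit_shape_inf_def)

text \<open>Convexity of \<open>limit_shape_inf\<close>, uniformly in the sign of \<open>s\<close>: replacing \<open>u\<close> by \<open>u - s\<close>
  tilts one geometric variable, and this bounds the change of its log normalising factor.\<close>

lemma shape_tilt:
  assumes "0 < u" "s < u"
  shows "limit_shape_inf (u - s) - limit_shape_inf u \<le> s * bose (u - s)"
proof (cases "s \<ge> 0")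
  case True
  then show ?thesis using shape_increment(2)[of "u - s" u] assms by simp
next
  case False
  then show ?thesis using shape_increment(1)[of u "u - s"] assms by (simp add: algebra_simps)
qed

lemma isCont_shape: "0 < u \<Longrightarrow> isCont limit_shape_inf u"
  using shape_has_derivative DERIV_isCont by blast

lemma shape_tendsto_0: "(limit_shape_inf \<longlongrightarrow> 0) at_top"
proof -
  have "((\<lambda>t::real. - ln (1 - exp (- t))) \<longlongrightarrow> - ln (1 - 0)) at_top"
    by (intro tendsto_intros filterlim_compose[OF exp_at_bot] filterlim_uminus_at_bot_at_top) auto
  then show ?thesis by (simp add: limit_shape_inf_def[abs_def])
qed

lemma continuous_on_dilog_exp: "continuous_on {0..} dilog_exp"
  unfolding dilog_exp_def
  by (rule continuous_on_compose2[OF continuous_on_Li2]) (auto intro!: continuous_intros)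

lemma isCont_dilog_exp: "0 < u \<Longrightarrow> isCont dilog_exp u"
  using continuous_on_interior[OF continuous_on_dilog_exp, of u] by simp

lemma dilog_exp_0: "dilog_exp 0 = 0"
  by (simp add: dilog_exp_def Li2_0)

lemma dilog_exp_has_derivative:
  assumes "0 < u"
  shows "(dilog_exp has_real_derivative u * bose u) (at u)"
proof -
  have "(dilog_exp has_real_derivative
      - ln (1 - (1 - exp (-u))) / (1 - exp (-u)) * exp (-u)) (at u)"
    unfolding dilog_exp_def using assms
    by (intro DERIV_chain2[OF Li2_has_derivative]) (auto intro!: derivative_eq_intros)
  moreover have "- ln (1 - (1 - exp (-u))) / (1 - exp (-u)) * exp (-u) = u * bose u"
  proof -
    have "exp (-u) / (1 - exp (-u)) = bose u"
      using assms by (simp add: bose_def exp_minus field_simps)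
    then show ?thesis by (metis (no_types, lifting) diff_diff_eq2 add_diff_cancel_left'
          ln_exp minus_minus times_divide_eq_left times_divide_eq_right)
  qed
  ultimately show ?thesis by simp
qed

lemma dilog_exp_increment:
  assumes "0 < u" "u \<le> v"
  shows "(v - u) * (v * bose v) \<le> dilog_exp v - dilog_exp u"
    and "dilog_exp v - dilog_exp u \<le> (v - u) * (u * bose u)"
proof -
  have "(v - u) * (v * bose v) \<le> dilog_exp v - dilog_exp u
      \<and> dilog_exp v - dilog_exp u \<le> (v - u) * (u * bose u)"
  proof (cases "u = v")
    case False
    then obtain w where w: "u < w" "w < v"
      "dilog_exp v - dilog_exp u = (v - u) * (w * bose w)"
      using assms MVT2[of u v dilog_exp "\<lambda>w. w * bose w"] dilog_exp_has_derivative by force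
    have "v * bose v \<le> w * bose w" "w * bose w \<le> u * bose u"
      using w assms by (auto intro!: times_bose_antimono)
    then have "(v - u) * (v * bose v) \<le> (v - u) * (w * bose w)"
      "(v - u) * (w * bose w) \<le> (v - u) * (u * bose u)"
      using assms by (auto intro!: mult_left_mono)
    then show ?thesis using w by simp
  qed simp
  then show "(v - u) * (v * bose v) \<le> dilog_exp v - dilog_exp u"
    and "dilog_exp v - dilog_exp u \<le> (v - u) * (u * bose u)" by auto
qed

lemma dilog_exp_increment_0:
  assumes "0 < v"
  shows "v * (v * bose v) \<le> dilog_exp v" and "dilog_exp v \<le> v"
proof -
  obtain w where w: "0 < w" "w < v" "dilog_exp v - dilog_exp 0 = (v - 0) * (w * bose w)"
  proof -
    have c: "continuous_on {0..v} dilog_exp"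
      by (rule continuous_on_subset[OF continuous_on_dilog_exp]) auto
    obtain l z where "0 < z" "z < v" "DERIV dilog_exp z :> l"
      "dilog_exp v - dilog_exp 0 = (v - 0) * l"
      using MVT[OF assms c] dilog_exp_has_derivative real_differentiable_def by blast
    moreover from this have "l = z * bose z"
      using DERIV_unique dilog_exp_has_derivative by blast
    ultimately show thesis using that by blast
  qed
  have "v * bose v \<le> w * bose w" "w * bose w \<le> 1"
    using w by (auto intro!: times_bose_antimono bose_times_le_1)
  then show "v * (v * bose v) \<le> dilog_exp v" "dilog_exp v \<le> v"
    using w assms by (auto simp: dilog_exp_0 intro!: mult_left_mono mult_left_le)
qed

lemma dilog_exp_pos: "0 < v \<Longrightarrow> 0 < dilog_exp v"
  using dilog_exp_increment_0(1)[of v] bose_pos[of v] by (smt (verit) mult_pos_pos)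

lemma dilog_exp_mono: "0 < u \<Longrightarrow> u \<le> v \<Longrightarrow> dilog_exp u \<le> dilog_exp v"
  using dilog_exp_increment(1)[of u v] bose_pos[of v]
  by (smt (verit) mult_nonneg_nonneg)

lemma dilog_exp_tendsto: "(dilog_exp \<longlongrightarrow> pi\<^sup>2 / 6) at_top"
proof -
  have "(Li2 \<longlongrightarrow> Li2 1) (at 1 within {0..1})"
    using continuous_on_Li2 by (auto simp: continuous_on_def)
  moreover have "filterlim (\<lambda>u::real. 1 - exp (- u)) (at 1 within {0..1}) at_top"
  proof -
    have "((\<lambda>u::real. 1 - exp (- u)) \<longlongrightarrow> 1 - 0) at_top"
      by (intro tendsto_intros filterlim_compose[OF exp_at_bot] filterlim_uminus_at_bot_at_top)
    moreover have "\<forall>\<^sub>F u::real in at_top. 1 - exp (- u) \<in> {0..1} \<and> 1 - exp (- u) \<noteq> 1"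
      using eventually_ge_at_top[of 0] by eventually_elim auto
    ultimately show ?thesis by (simp add: filterlim_at)
  qed
  ultimately have "((\<lambda>u. Li2 (1 - exp (- u))) \<longlongrightarrow> Li2 1) at_top"
    by (rule filterlim_compose)
  then show ?thesis by (simp add: dilog_exp_def[abs_def] Li2_1)
qed

text \<open>Concavity of \<open>dilog_exp\<close> makes \<open>dilog_exp u / u\<close> decrease. The strict decrease after one more
  division by \<open>u\<close> gives the uniqueness of the solution \<open>T\<close>, and also shows that a
  tilt stronger than the critical one has a mean weight below the prescribed weight.\<close>

lemma dilog_exp_div_square_strict_antimono:
  assumes "0 < u" "u < v"
  shows "dilog_exp v / v\<^sup>2 < dilog_exp u / u\<^sup>2"
proof -
  have "dilog_exp v - dilog_exp u \<le> (v - u) * (u * bose u)"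
    using assms by (intro dilog_exp_increment) auto
  also have "\<dots> \<le> (v - u) * (dilog_exp u / u)"
    using assms dilog_exp_increment_0(1)[of u] by (intro mult_left_mono) (auto simp: field_simps)
  finally have "dilog_exp v \<le> v * dilog_exp u / u" using assms by (simp add: field_simps)
  then have "dilog_exp v / v\<^sup>2 \<le> dilog_exp u / (u * v)"
    using assms by (simp add: field_simps power2_eq_square)
  also have "\<dots> < dilog_exp u / u\<^sup>2"
    using assms dilog_exp_pos[of u] by (simp add: field_simps power2_eq_square)
  finally show ?thesis .
qed

lemma vartheta_fixed_point_iff:
  assumes "0 < \<tau>" "0 < T" "0 \<le> q"
  shows "\<tau> * vartheta q T = T \<longleftrightarrow> dilog_exp T / T\<^sup>2 = 1 / \<tau>\<^sup>2 - q / 2"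
proof -
  define A where "A = q * T\<^sup>2 / 2 + dilog_exp T"
  have A: "0 \<le> A" using dilog_exp_pos[of T] assms by (simp add: A_def)
  have "\<tau> * vartheta q T = T \<longleftrightarrow> sqrt A = T / \<tau>"
    using assms by (auto simp: vartheta_def dilog_exp_def A_def field_simps)
  also have "\<dots> \<longleftrightarrow> A = (T / \<tau>)\<^sup>2"
    using A assms by (metis divide_nonneg_pos less_imp_le real_sqrt_abs real_sqrt_pow2 abs_of_nonneg)
  also have "\<dots> \<longleftrightarrow> dilog_exp T / T\<^sup>2 = 1 / \<tau>\<^sup>2 - q / 2"
    using assms by (auto simp: A_def field_simps)
  finally show ?thesis .
qed

lemma vartheta_fixed_point_ex1:
  assumes "0 < \<tau>" "0 \<le> q" "0 < q \<longrightarrow> \<tau> < sqrt (2 / q)"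
  shows "\<exists>!T. 0 < T \<and> \<tau> * vartheta q T = T"
proof -
  define c where "c = 1 / \<tau>\<^sup>2 - q / 2"
  have c: "0 < c"
  proof (cases "q = 0")
    case False
    then have "\<tau> < sqrt (2 / q)" "0 < q" using assms by auto
    then have "\<tau>\<^sup>2 < (sqrt (2 / q))\<^sup>2" using assms by (intro power_strict_mono) auto
    then have "\<tau>\<^sup>2 < 2 / q" using \<open>0 < q\<close> by simp
    then show ?thesis using assms \<open>0 < q\<close> by (simp add: c_def field_simps)
  qed (use assms in \<open>simp add: c_def\<close>)
  \<comment> \<open>As \<open>u * bose u \<le> dilog_exp u / u \<le> 1\<close>, the quotient \<open>dilog_exp u / u\<^sup>2\<close> is at least \<open>c\<close>
     at the point where \<open>bose u = c\<close>, and at most \<open>c\<close> at \<open>1 / c\<close>.\<close>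
  define u where "u = ln (1 + 1 / c)"
  have u: "0 < u" "u \<le> 1 / c"
    using c ln_add_one_self_le_self[of "1 / c"] ln_gt_zero[of "1 + 1 / c"] by (auto simp: u_def)
  have "bose u = c" using c by (simp add: u_def bose_def add_pos_pos)
  then have "u * (u * c) \<le> dilog_exp u" using dilog_exp_increment_0(1)[of u] u by simp
  then have hi: "c \<le> dilog_exp u / u\<^sup>2"
    using u by (simp add: pos_le_divide_eq power2_eq_square mult.commute mult.left_commute)
  have "dilog_exp (1 / c) / (1 / c)\<^sup>2 \<le> (1 / c) / (1 / c)\<^sup>2"
    using dilog_exp_increment_0(2)[of "1 / c"] c by (intro divide_right_mono) auto
  also have "\<dots> = c" using c by (simp add: power2_eq_square)
  finally have lo: "dilog_exp (1 / c) / (1 / c)\<^sup>2 \<le> c" .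
  have cont: "\<forall>x. u \<le> x \<and> x \<le> 1 / c \<longrightarrow> isCont (\<lambda>T. dilog_exp T / T\<^sup>2) x"
  proof (intro allI impI)
    fix x assume "u \<le> x \<and> x \<le> 1 / c"
    then have "0 < x" using u by simp
    then show "isCont (\<lambda>T. dilog_exp T / T\<^sup>2) x"
      by (intro isCont_divide isCont_dilog_exp isCont_power continuous_ident) auto
  qed
  obtain T where T: "u \<le> T" "dilog_exp T / T\<^sup>2 = c"
    using IVT2[OF lo hi u(2) cont] by blast
  have T0: "0 < T" using T u by simp
  show ?thesis
  proof (rule ex1I[of _ T])
    have "\<tau> * vartheta q T = T"
      using T(2) T0 vartheta_fixed_point_iff[OF assms(1) T0 assms(2)] unfolding c_def by blast
    then show "0 < T \<and> \<tau> * vartheta q T = T" using T0 by blast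
  next
    fix S assume S: "0 < S \<and> \<tau> * vartheta q S = S"
    then have "dilog_exp S / S\<^sup>2 = c"
      using vartheta_fixed_point_iff[of \<tau> S q] assms(1,2) unfolding c_def by blast
    then show "S = T"
      using dilog_exp_div_square_strict_antimono[of S T]
        dilog_exp_div_square_strict_antimono[of T S] S T T0 by (metis less_irrefl linorder_cases)
  qed
qed

section \<open>Counting by exponential tilting\<close>

text \<open>The reduced form of a partition: \<open>D j\<close> is the excess of the difference between consecutive
  parts over its prescribed minimum. Every excess is free, and one unit of \<open>D j\<close> raises the
  first \<open>Suc j\<close> parts by one.\<close>

definition configs :: "nat \<Rightarrow> nat \<Rightarrow> (nat \<Rightarrow> nat) set" where
  "configs k m = {D \<in> {..<k} \<rightarrow>\<^sub>E UNIV. (\<Sum>j<k. Suc j * D j) = m}"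

text \<open>The logarithm of the generating function of \<open>configs k\<close> at \<open>exp (- w)\<close>.\<close>

definition log_gf :: "nat \<Rightarrow> real \<Rightarrow> real" where
  "log_gf k w = (\<Sum>j<k. limit_shape_inf (w * real (Suc j)))"

text \<open>The mean weight under the tilt \<open>w\<close>, equal to minus the derivative of \<open>log_gf k\<close>.\<close>

definition mean_weight :: "nat \<Rightarrow> real \<Rightarrow> real" where
  "mean_weight k w = (\<Sum>j<k. real (Suc j) * bose (w * real (Suc j)))"

lemma finite_configs: "finite (configs k m)"
proof (rule finite_subset)
  show "configs k m \<subseteq> {..<k} \<rightarrow>\<^sub>E {..m}"
  proof
    fix D assume D: "D \<in> configs k m"
    have "D j \<le> m" if "j < k" for j
    proof -
      have "D j \<le> Suc j * D j" by simp
      also have "\<dots> \<le> (\<Sum>j<k. Suc j * D j)" using that by (intro member_le_sum) auto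
      finally show ?thesis using D by (simp add: configs_def)
    qed
    then show "D \<in> {..<k} \<rightarrow>\<^sub>E {..m}" using D by (auto simp: configs_def PiE_iff)
  qed
qed (auto intro: finite_PiE)

text \<open>Extra weight can always be put into \<open>D 0\<close>, which has weight one per unit.\<close>

lemma card_configs_mono:
  assumes "0 < k" "m \<le> m'"
  shows "card (configs k m) \<le> card (configs k m')"
proof (rule card_inj_on_le)
  let ?g = "\<lambda>D::nat \<Rightarrow> nat. D(0 := D 0 + (m' - m))"
  show "inj_on ?g (configs k m)"
  proof (rule inj_onI, rule ext)
    fix D E j assume "?g D = ?g E"
    then have "?g D j = ?g E j" by simp
    then show "D j = E j" by (cases "j = 0") auto
  qed
  show "?g ` configs k m \<subseteq> configs k m'"
  proof
    fix E assume "E \<in> ?g ` configs k m"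
    then obtain D where D: "D \<in> configs k m" "E = ?g D" by blast
    have "(\<Sum>j<k. Suc j * E j) = (\<Sum>j<k. Suc j * D j + (if j = 0 then m' - m else 0))"
      by (rule sum.cong) (auto simp: D)
    also have "\<dots> = m + (m' - m)" using D(1) assms by (simp add: sum.distrib configs_def)
    finally show "E \<in> configs k m'"
      using D assms by (auto simp: configs_def PiE_iff extensional_def)
  qed
qed (rule finite_configs)

text \<open>A product of geometric series: the multiplicities \<open>D j\<close> behave like independent
  geometric variables, and \<open>exp (limit_shape_inf a) = 1 / (1 - exp (- a))\<close> is the
  normalising factor of a single one.\<close>

lemma sum_exp_box:
  fixes a :: "nat \<Rightarrow> real"
  shows "(\<Sum>D\<in>{..<k} \<rightarrow>\<^sub>E {..<M}. exp (- (\<Sum>j<k. a j * real (D j))))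
    = (\<Prod>j<k. \<Sum>d<M. exp (- a j) ^ d)"
proof -
  have "exp (- (\<Sum>j<k. a j * real (D j))) = (\<Prod>j<k. exp (- a j) ^ D j)" for D
    by (simp add: exp_sum mult.commute flip: sum_negf exp_of_nat_mult)
  then show ?thesis by (simp add: prod_sum_PiE)
qed

lemma exp_shape: "0 < u \<Longrightarrow> exp (limit_shape_inf u) = 1 / (1 - exp (- u))"
  by (simp add: limit_shape_inf_def exp_minus inverse_eq_divide)

lemma sum_exp_le:
  fixes a :: "nat \<Rightarrow> real"
  assumes "finite S" "S \<subseteq> {..<k} \<rightarrow>\<^sub>E UNIV" "\<And>j. j < k \<Longrightarrow> 0 < a j"
  shows "(\<Sum>D\<in>S. exp (- (\<Sum>j<k. a j * real (D j)))) \<le> exp (\<Sum>j<k. limit_shape_inf (a j))"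
proof -
  define M where "M = Suc (\<Sum>D\<in>S. \<Sum>j<k. D j)"
  have "S \<subseteq> {..<k} \<rightarrow>\<^sub>E {..<M}"
  proof
    fix D assume D: "D \<in> S"
    have "D j < M" if "j < k" for j
    proof -
      have "D j \<le> (\<Sum>j<k. D j)" using that by (intro member_le_sum) auto
      also have "\<dots> \<le> (\<Sum>D\<in>S. \<Sum>j<k. D j)"
        using D assms(1) by (intro member_le_sum) auto
      finally show ?thesis by (simp add: M_def)
    qed
    then show "D \<in> {..<k} \<rightarrow>\<^sub>E {..<M}" using D assms(2) by (auto simp: PiE_iff)
  qed
  then have "(\<Sum>D\<in>S. exp (- (\<Sum>j<k. a j * real (D j))))
      \<le> (\<Sum>D\<in>{..<k} \<rightarrow>\<^sub>E {..<M}. exp (- (\<Sum>j<k. a j * real (D j))))"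
    by (intro sum_mono2) (auto intro: finite_PiE)
  also have "\<dots> = (\<Prod>j<k. \<Sum>d<M. exp (- a j) ^ d)" by (rule sum_exp_box)
  also have "\<dots> \<le> (\<Prod>j<k. exp (limit_shape_inf (a j)))"
  proof (intro prod_mono conjI)
    fix j assume "j \<in> {..<k}"
    then have a: "0 < a j" using assms(3) by simp
    then show "(\<Sum>d<M. exp (- a j) ^ d) \<le> exp (limit_shape_inf (a j))"
      by (auto simp: exp_shape sum_gp_strict intro!: divide_right_mono)
  qed (auto intro: sum_nonneg)
  finally show ?thesis by (simp add: exp_sum)
qed

lemma sum_exp_box_approaches:
  fixes a :: "nat \<Rightarrow> real"
  assumes "\<And>j. j < k \<Longrightarrow> 0 < a j" and "c < exp (\<Sum>j<k. limit_shape_inf (a j))"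
  shows "\<exists>M. c < (\<Sum>D\<in>{..<k} \<rightarrow>\<^sub>E {..<M}. exp (- (\<Sum>j<k. a j * real (D j))))"
proof -
  have "(\<lambda>M. \<Prod>j<k. \<Sum>d<M. exp (- a j) ^ d) \<longlonglongrightarrow> (\<Prod>j<k. exp (limit_shape_inf (a j)))"
  proof (rule tendsto_prod)
    fix j assume "j \<in> {..<k}"
    then have a: "0 < a j" using assms(1) by simp
    then have "(\<lambda>d. exp (- a j) ^ d) sums (1 / (1 - exp (- a j)))"
      by (intro geometric_sums) auto
    then show "(\<lambda>M. \<Sum>d<M. exp (- a j) ^ d) \<longlonglongrightarrow> exp (limit_shape_inf (a j))"
      using a by (simp add: sums_def exp_shape)
  qed
  then have "\<forall>\<^sub>F M in sequentially. c < (\<Prod>j<k. \<Sum>d<M. exp (- a j) ^ d)"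
    using assms(2) by (intro order_tendstoD(1)) (auto simp: exp_sum)
  then show ?thesis unfolding sum_exp_box eventually_sequentially by blast
qed

text \<open>The tangent inequality of the convex function \<open>log_gf k\<close>, on either side of \<open>w\<close>.\<close>

lemma log_gf_tangent:
  assumes "0 < w" "0 < w'"
  shows "log_gf k w \<le> log_gf k w' + (w' - w) * mean_weight k w"
proof -
  have "limit_shape_inf (w * real (Suc j))
      \<le> limit_shape_inf (w' * real (Suc j)) + (w' - w) * (real (Suc j) * bose (w * real (Suc j)))"
    for j
  proof -
    have "0 < w * real (Suc j)" "0 < w' * real (Suc j)" using assms by simp_all
    then show ?thesis
      using shape_tilt[of "w' * real (Suc j)" "(w' - w) * real (Suc j)"]
      by (simp add: left_diff_distrib mult.assoc del: of_nat_Suc)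
  qed
  then have "log_gf k w \<le> (\<Sum>j<k. limit_shape_inf (w' * real (Suc j))
      + (w' - w) * (real (Suc j) * bose (w * real (Suc j))))"
    unfolding log_gf_def by (intro sum_mono) auto
  then show ?thesis by (simp add: sum.distrib sum_distrib_left log_gf_def mean_weight_def)
qed

text \<open>The number of configurations with an atypical tail sum: Markov's inequality for
  the weights tilted by \<open>s\<close> on the indices from \<open>j0\<close> on. Negative \<open>s\<close> are allowed, so the
  bound covers both the upper and the lower deviations.\<close>

lemma card_configs_tail_le:
  assumes "0 < w" and s: "\<And>j. j0 \<le> j \<Longrightarrow> j < k \<Longrightarrow> s < w * real (Suc j)"
  shows "real (card {D \<in> configs k m. c \<le> s * real (\<Sum>j\<in>{j0..<k}. D j)})
    \<le> exp (w * real m - c + log_gf k w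
          + s * (\<Sum>j\<in>{j0..<k}. bose (w * real (Suc j) - s)))"
proof -
  define S where "S = {D \<in> configs k m. c \<le> s * real (\<Sum>j\<in>{j0..<k}. D j)}"
  define a where "a j = w * real (Suc j) - (if j0 \<le> j then s else 0)" for j
  have S: "finite S" "S \<subseteq> {..<k} \<rightarrow>\<^sub>E UNIV"
    unfolding S_def
    by (rule finite_subset[OF _ finite_configs[of k m]], blast) (auto simp: configs_def)
  have tail: "(\<Sum>j<k. if j0 \<le> j then F j else 0) = (\<Sum>j\<in>{j0..<k}. F j)" for F :: "nat \<Rightarrow> real"
    by (simp flip: sum.inter_filter) (rule sum.cong, auto)
  have "exp (c - w * real m) \<le> exp (- (\<Sum>j<k. a j * real (D j)))" if "D \<in> S" for D
  proof -
    have "(\<Sum>j<k. a j * real (D j)) = (\<Sum>j<k. w * real (Suc j * D j)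
        - (if j0 \<le> j then s * real (D j) else 0))"
      by (rule sum.cong) (auto simp: a_def algebra_simps)
    also have "\<dots> = w * (\<Sum>j<k. real (Suc j * D j)) - (\<Sum>j\<in>{j0..<k}. s * real (D j))"
      unfolding sum_subtractf tail by (simp add: sum_distrib_left)
    also have "(\<Sum>j<k. real (Suc j * D j)) = real m"
      using that by (simp only: S_def configs_def mem_Collect_eq flip: of_nat_sum)
    finally have "(\<Sum>j<k. a j * real (D j)) = w * real m - (\<Sum>j\<in>{j0..<k}. s * real (D j))" .
    moreover have "c \<le> (\<Sum>j\<in>{j0..<k}. s * real (D j))"
      using that by (simp add: S_def sum_distrib_left)
    ultimately show ?thesis by simp
  qed
  then have "real (card S) * exp (c - w * real m) \<le> (\<Sum>D\<in>S. exp (- (\<Sum>j<k. a j * real (D j))))"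
    by (intro sum_bounded_below)
  also have "\<dots> \<le> exp (\<Sum>j<k. limit_shape_inf (a j))"
    by (rule sum_exp_le[OF S]) (use assms in \<open>auto simp: a_def simp del: of_nat_Suc\<close>)
  also have "(\<Sum>j<k. limit_shape_inf (a j)) \<le> (\<Sum>j<k. limit_shape_inf (w * real (Suc j))
      + (if j0 \<le> j then s * bose (w * real (Suc j) - s) else 0))"
  proof (rule sum_mono)
    fix j assume "j \<in> {..<k}"
    then show "limit_shape_inf (a j) \<le> limit_shape_inf (w * real (Suc j))
        + (if j0 \<le> j then s * bose (w * real (Suc j) - s) else 0)"
      using shape_tilt[of "w * real (Suc j)" s] s[of j] assms(1) by (auto simp: a_def)
  qed
  also have "\<dots> = log_gf k w + s * (\<Sum>j\<in>{j0..<k}. bose (w * real (Suc j) - s))"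
    unfolding sum.distrib tail by (simp add: log_gf_def sum_distrib_left)
  finally have "real (card S) * exp (c - w * real m)
      \<le> exp (log_gf k w + s * (\<Sum>j\<in>{j0..<k}. bose (w * real (Suc j) - s)))" by simp
  then have "real (card S) \<le> exp (log_gf k w
      + s * (\<Sum>j\<in>{j0..<k}. bose (w * real (Suc j) - s))) * exp (w * real m - c)"
    by (simp add: exp_diff field_simps)
  then show ?thesis by (simp add: S_def algebra_simps flip: exp_add)
qed

text \<open>Markov's inequality for the weight: on a set where \<open>(w - w') * weight\<close> is at least \<open>c\<close>, the
  tilt \<open>w\<close> is dominated by the tilt \<open>w'\<close> times \<open>exp (- c)\<close>. With \<open>w' < w\<close> this bounds large
  weights, with \<open>w' > w\<close> small ones.\<close>

lemma sum_exp_weight_tail_le: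
  assumes "finite S" "S \<subseteq> {..<k} \<rightarrow>\<^sub>E UNIV" "0 < w" "0 < w'"
    and c: "\<And>D. D \<in> S \<Longrightarrow> c \<le> (w - w') * real (\<Sum>j<k. Suc j * D j)"
  shows "(\<Sum>D\<in>S. exp (- w * real (\<Sum>j<k. Suc j * D j)))
    \<le> exp (log_gf k w - (c - (w - w') * mean_weight k w'))"
proof -
  have "(\<Sum>D\<in>S. exp (- w * real (\<Sum>j<k. Suc j * D j)))
      \<le> (\<Sum>D\<in>S. exp (- c) * exp (- (\<Sum>j<k. (w' * real (Suc j)) * real (D j))))"
  proof (rule sum_mono)
    fix D assume "D \<in> S"
    have "(\<Sum>j<k. (w' * real (Suc j)) * real (D j)) = w' * real (\<Sum>j<k. Suc j * D j)"
      by (simp add: sum_distrib_left algebra_simps)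
    then show "exp (- w * real (\<Sum>j<k. Suc j * D j))
        \<le> exp (- c) * exp (- (\<Sum>j<k. (w' * real (Suc j)) * real (D j)))"
      using c[OF \<open>D \<in> S\<close>] by (simp add: left_diff_distrib flip: exp_add)
  qed
  also have "\<dots> \<le> exp (- c) * exp (log_gf k w')"
    unfolding log_gf_def sum_distrib_left[symmetric]
    by (intro mult_left_mono sum_exp_le) (use assms in auto)
  also have "\<dots> \<le> exp (log_gf k w - (c - (w - w') * mean_weight k w'))"
    using log_gf_tangent[of w' w k] assms by (simp flip: exp_add)
  finally show ?thesis .
qed

text \<open>The number of configurations of weight exactly \<open>m\<close> cannot be read off from tilted
  sums, which only see ranges of weights. As that number increases with \<open>m\<close>, it
  suffices that under the tilt \<open>w\<close> a fixed share of the mass sits on weights in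
  \<open>{m'..m}\<close>. The neighbouring tilts \<open>w1\<close> and \<open>w3\<close> bound the mass on the two sides.\<close>

lemma card_configs_lower_bound:
  assumes "0 < k" "0 < w1" "w1 < w" "w < w3"
    and hi: "ln 4 \<le> (w - w1) * (real (Suc m) - mean_weight k w1)"
    and lo: "ln 4 \<le> (w3 - w) * (mean_weight k w3 - real m')"
  shows "exp (log_gf k w) \<le> 4 * real (Suc m) * exp (- w * real m') * real (card (configs k m))"
proof -
  define N where "N D = (\<Sum>j<k. Suc j * D j)" for D :: "nat \<Rightarrow> nat"
  define Z where "Z = exp (log_gf k w)"
  have quarter: "exp (log_gf k w - c) \<le> Z / 4" if "ln 4 \<le> c" for c
  proof -
    have "exp (log_gf k w - c) \<le> exp (log_gf k w - ln 4)" using that by simp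
    then show ?thesis by (simp add: Z_def exp_diff)
  qed
  have "3 / 4 * Z < exp (\<Sum>j<k. limit_shape_inf (w * real (Suc j)))"
    by (simp add: Z_def log_gf_def)
  from sum_exp_box_approaches[OF _ this] assms obtain M where
    "3 / 4 * Z < (\<Sum>D\<in>{..<k} \<rightarrow>\<^sub>E {..<M}. exp (- (\<Sum>j<k. w * real (Suc j) * real (D j))))"
    by auto
  moreover have "(\<Sum>j<k. w * real (Suc j) * real (D j)) = w * real (N D)" for D
    by (simp add: N_def sum_distrib_left algebra_simps)
  moreover define B where "B = {..<k} \<rightarrow>\<^sub>E {..<M}"
  ultimately have mass: "3 / 4 * Z < (\<Sum>D\<in>B. exp (- w * real (N D)))" by simp
  have B: "finite B" "B \<subseteq> {..<k} \<rightarrow>\<^sub>E UNIV" by (auto simp: B_def PiE_iff intro: finite_PiE)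
  \<comment> \<open>At most a quarter of the total mass lies on either side of \<open>{m'..m}\<close>, and a finite box
     carries more than three quarters, so more than a quarter remains on \<open>{m'..m}\<close>.\<close>
  define B1 B2 B3 where "B1 = {D \<in> B. m < N D}" and "B2 = {D \<in> B. N D < m'}"
    and "B3 = {D \<in> B. m' \<le> N D \<and> N D \<le> m}"
  have "(\<Sum>D\<in>B1. exp (- w * real (N D)))
      \<le> exp (log_gf k w - ((w - w1) * real (Suc m) - (w - w1) * mean_weight k w1))"
    unfolding N_def
    by (rule sum_exp_weight_tail_le)
       (use B assms in \<open>auto simp: B1_def N_def simp del: of_nat_Suc of_nat_sum intro!: mult_left_mono\<close>)
  also have "\<dots> \<le> Z / 4" using hi by (intro quarter) (simp add: algebra_simps)
  finally have 1: "(\<Sum>D\<in>B1. exp (- w * real (N D))) \<le> Z / 4" .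
  have "(\<Sum>D\<in>B2. exp (- w * real (N D)))
      \<le> exp (log_gf k w - ((w - w3) * real m' - (w - w3) * mean_weight k w3))"
    unfolding N_def
    by (rule sum_exp_weight_tail_le)
       (use B assms in \<open>auto simp: B2_def N_def simp del: of_nat_Suc of_nat_sum intro!: mult_left_mono_neg\<close>)
  also have "\<dots> \<le> Z / 4" using lo by (intro quarter) (simp add: algebra_simps)
  finally have 2: "(\<Sum>D\<in>B2. exp (- w * real (N D))) \<le> Z / 4" .
  have "(\<Sum>D\<in>B3. exp (- w * real (N D))) \<le> real (card B3) * exp (- w * real m')"
    using assms by (intro sum_bounded_above) (auto simp: B3_def)
  also have "card B3 \<le> card (\<Union>l\<le>m. configs k l)"
  proof (rule card_mono)
    show "finite (\<Union>l\<le>m. configs k l)" by (simp add: finite_configs)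
    show "B3 \<subseteq> (\<Union>l\<le>m. configs k l)"
      using B by (auto simp: B3_def configs_def N_def simp del: mult_Suc)
  qed
  also have "\<dots> \<le> (\<Sum>l\<le>m. card (configs k l))" by (rule card_UN_le) auto
  also have "\<dots> \<le> (\<Sum>l\<le>m. card (configs k m))"
    by (intro sum_mono card_configs_mono) (use assms in auto)
  finally have 3: "(\<Sum>D\<in>B3. exp (- w * real (N D)))
      \<le> real (Suc m) * real (card (configs k m)) * exp (- w * real m')"
    by (simp add: algebra_simps)
  have "(\<Sum>D\<in>B. exp (- w * real (N D))) \<le> (\<Sum>D\<in>B1 \<union> B2 \<union> B3. exp (- w * real (N D)))"
    using B by (intro sum_mono2) (auto simp: B1_def B2_def B3_def)
  also have "\<dots> \<le> (\<Sum>D\<in>B1. exp (- w * real (N D))) + (\<Sum>D\<in>B2. exp (- w * real (N D)))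
      + (\<Sum>D\<in>B3. exp (- w * real (N D)))"
  proof -
    have "sum f (X \<union> Y) \<le> sum f X + sum f Y" if "X \<subseteq> B" "Y \<subseteq> B" "\<And>D. 0 \<le> f D"
      for X Y :: "(nat \<Rightarrow> nat) set" and f :: "(nat \<Rightarrow> nat) \<Rightarrow> real"
      using that B sum_nonneg[of "X \<inter> Y" f] by (simp add: sum_Un finite_subset)
    note un = this[of _ _ "\<lambda>D. exp (- w * real (N D))"]
    show ?thesis using un[of "B1 \<union> B2" B3] un[of B1 B2]
      by (auto simp: B1_def B2_def B3_def)
  qed
  finally show ?thesis using mass 1 2 3 by (simp add: Z_def algebra_simps)
qed

section \<open>Riemann sums\<close>

text \<open>The sum \<open>w\<^sup>2 * mean_weight k w\<close> is a right Riemann sum with step \<open>w\<close> of the decreasing function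
  \<open>u * bose u\<close> over \<open>{0..w * k}\<close>.\<close>

lemma mean_weight_le:
  assumes "0 < w"
  shows "w\<^sup>2 * mean_weight k w \<le> dilog_exp (w * real k)"
proof (induction k)
  case (Suc k)
  define u where "u = w * real (Suc k)"
  have "w * (u * bose u) \<le> dilog_exp u - dilog_exp (w * real k)"
  proof (cases "k = 0")
    case True
    then show ?thesis using dilog_exp_increment_0(1)[of w] assms by (simp add: u_def dilog_exp_0)
  next
    case False
    then show ?thesis using dilog_exp_increment(1)[of "w * real k" u] assms
      by (simp add: u_def algebra_simps)
  qed
  moreover have "w\<^sup>2 * mean_weight (Suc k) w = w\<^sup>2 * mean_weight k w + w * (u * bose u)"
    by (simp add: mean_weight_def u_def algebra_simps power2_eq_square)
  ultimately show ?case using Suc by (simp add: u_def)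
qed (simp add: mean_weight_def dilog_exp_0)

lemma mean_weight_ge:
  assumes "0 < w"
  shows "dilog_exp (w * real k) - w \<le> w\<^sup>2 * mean_weight k w"
proof -
  have "dilog_exp (w * real (Suc k)) - dilog_exp w \<le> w\<^sup>2 * mean_weight k w"
  proof (induction k)
    case (Suc k)
    define u where "u = w * real (Suc k)"
    have "0 < u" using assms by (simp add: u_def)
    then have "dilog_exp (w * real (Suc (Suc k))) - dilog_exp u \<le> w * (u * bose u)"
      using dilog_exp_increment(2)[of u "w * real (Suc (Suc k))"] assms
      by (simp add: u_def algebra_simps)
    moreover have "w\<^sup>2 * mean_weight (Suc k) w = w\<^sup>2 * mean_weight k w + w * (u * bose u)"
      by (simp add: mean_weight_def u_def algebra_simps power2_eq_square)
    ultimately show ?case using Suc by (simp add: u_def)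
  qed (simp add: mean_weight_def)
  moreover have "dilog_exp w \<le> w" using assms by (rule dilog_exp_increment_0)
  moreover have "dilog_exp (w * real k) \<le> dilog_exp (w * real (Suc k))"
    using dilog_exp_mono[of "w * real k" "w * real (Suc k)"] dilog_exp_pos[of w] assms
    by (cases "k = 0") (auto simp: dilog_exp_0 intro: less_imp_le)
  ultimately show ?thesis by simp
qed

text \<open>A right Riemann sum of the decreasing function \<open>bose\<close>, shifted by \<open>s\<close>. Multiplication by a
  negative \<open>s\<close> reverses the inequality, which then needs the sum compared with the integral
  started one step later.\<close>

lemma bose_sum_tilted:
  assumes "0 < w" "j0 \<le> k" "s < w * real j0"
  shows "s * (w * (\<Sum>j\<in>{j0..<k}. bose (w * real (Suc j) - s)))
    \<le> s * (limit_shape_inf (w * real (if 0 \<le> s then j0 else Suc j0) - s)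
          - limit_shape_inf (w * real k - s))"
proof -
  define F where "F j = limit_shape_inf (w * real j - s)" for j
  have step: "w * bose (w * real (Suc j) - s) \<le> F j - F (Suc j)"
    "F (Suc j) - F (Suc (Suc j)) \<le> w * bose (w * real (Suc j) - s)" if "j0 \<le> j" for j
  proof -
    have "w * real j0 \<le> w * real j" using that assms by simp
    then have "0 < w * real j - s" using assms by linarith
    then show "w * bose (w * real (Suc j) - s) \<le> F j - F (Suc j)"
      "F (Suc j) - F (Suc (Suc j)) \<le> w * bose (w * real (Suc j) - s)"
      using shape_increment(1)[of "w * real j - s" "w * real (Suc j) - s"]
        shape_increment(2)[of "w * real (Suc j) - s" "w * real (Suc (Suc j)) - s"] assms
      by (auto simp: F_def algebra_simps)
  qed
  have tele: "(\<Sum>j\<in>{j0..<k}. G j - G (Suc j)) = G j0 - G k" for G :: "nat \<Rightarrow> real"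
    using sum_Suc_diff'[OF assms(2), of "\<lambda>j. - G j"] by simp
  show ?thesis
  proof (cases "0 \<le> s")
    case True
    have "(\<Sum>j\<in>{j0..<k}. w * bose (w * real (Suc j) - s)) \<le> (\<Sum>j\<in>{j0..<k}. F j - F (Suc j))"
      by (intro sum_mono step) auto
    then have "w * (\<Sum>j\<in>{j0..<k}. bose (w * real (Suc j) - s)) \<le> F j0 - F k"
      unfolding tele by (simp add: sum_distrib_left)
    from mult_left_mono[OF this True] show ?thesis using True by (simp add: F_def)
  next
    case False
    have "0 < w * real k - s"
    proof -
      have "w * real j0 \<le> w * real k" using assms by simp
      then show ?thesis using assms by linarith
    qed
    then have "F (Suc k) \<le> F k"
      unfolding F_def using assms by (intro shape_antimono) auto
    moreover have "(\<Sum>j\<in>{j0..<k}. F (Suc j) - F (Suc (Suc j)))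
        \<le> (\<Sum>j\<in>{j0..<k}. w * bose (w * real (Suc j) - s))"
      by (intro sum_mono step) auto
    ultimately have "F (Suc j0) - F k \<le> w * (\<Sum>j\<in>{j0..<k}. bose (w * real (Suc j) - s))"
      unfolding tele[of "\<lambda>j. F (Suc j)"] by (simp add: sum_distrib_left)
    from mult_left_mono_neg[OF this, of s] show ?thesis using False by (simp add: F_def)
  qed
qed

section \<open>Asymptotics under the uniform measure\<close>

text \<open>A negligible share of \<open>B n\<close>: at most exponentially small in \<open>1 / z n\<close>, which is of order
  \<open>sqrt n\<close> in the applications. The multiplicative form is meaningful for empty \<open>B n\<close>, and the
  constant \<open>C\<close> makes the notion stable under finite unions.\<close>

definition exp_rare :: "(nat \<Rightarrow> real) \<Rightarrow> (nat \<Rightarrow> 'a set) \<Rightarrow> (nat \<Rightarrow> 'a set) \<Rightarrow> bool" where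
  "exp_rare z B A \<longleftrightarrow> (\<exists>C c. 0 < c \<and> (\<forall>\<^sub>F n in sequentially.
     real (card (A n)) \<le> C * exp (- c / z n) * real (card (B n))))"

lemma exp_rare_Un:
  assumes "exp_rare z B A1" "exp_rare z B A2" "\<forall>\<^sub>F n in sequentially. 0 < z n"
  shows "exp_rare z B (\<lambda>n. A1 n \<union> A2 n)"
proof -
  obtain C1 c1 C2 c2 where c: "0 < c1" "0 < c2"
    and 1: "\<forall>\<^sub>F n in sequentially. real (card (A1 n)) \<le> C1 * exp (- c1 / z n) * real (card (B n))"
    and 2: "\<forall>\<^sub>F n in sequentially. real (card (A2 n)) \<le> C2 * exp (- c2 / z n) * real (card (B n))"
    using assms(1,2) unfolding exp_rare_def by blast
  define c where "c = min c1 c2"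
  have "\<forall>\<^sub>F n in sequentially.
      real (card (A1 n \<union> A2 n)) \<le> (\<bar>C1\<bar> + \<bar>C2\<bar>) * exp (- c / z n) * real (card (B n))"
    using 1 2 assms(3)
  proof eventually_elim
    case (elim n)
    have "C1 * exp (- c1 / z n) \<le> \<bar>C1\<bar> * exp (- c / z n)"
      "C2 * exp (- c2 / z n) \<le> \<bar>C2\<bar> * exp (- c / z n)"
      using elim(3) by (auto intro!: mult_mono divide_right_mono simp: c_def)
    then have "C1 * exp (- c1 / z n) * real (card (B n)) + C2 * exp (- c2 / z n) * real (card (B n))
        \<le> \<bar>C1\<bar> * exp (- c / z n) * real (card (B n)) + \<bar>C2\<bar> * exp (- c / z n) * real (card (B n))"
      by (intro add_mono mult_right_mono) auto
    moreover have "real (card (A1 n \<union> A2 n)) \<le> real (card (A1 n)) + real (card (A2 n))"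
      using card_Un_le[of "A1 n" "A2 n"] by linarith
    ultimately show ?case using elim by (simp add: algebra_simps)
  qed
  moreover have "0 < c" using c by (simp add: c_def)
  ultimately show ?thesis unfolding exp_rare_def by blast
qed

lemma exp_rare_UN:
  assumes "finite I" "\<And>i. i \<in> I \<Longrightarrow> exp_rare z B (A i)" "\<forall>\<^sub>F n in sequentially. 0 < z n"
  shows "exp_rare z B (\<lambda>n. \<Union>i\<in>I. A i n)"
  using assms(1,2)
proof (induction I)
  case empty
  have "exp_rare z B (\<lambda>n. {})"
    unfolding exp_rare_def by (intro exI[of _ 0] exI[of _ 1]) auto
  then show ?case by simp
next
  case (insert i I)
  then show ?case using exp_rare_Un[OF _ _ assms(3), of B "A i" "\<lambda>n. \<Union>i\<in>I. A i n"] by simp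
qed

lemma exp_rare_mono:
  assumes "exp_rare z B A" "\<forall>\<^sub>F n in sequentially. card (A' n) \<le> card (A n)"
  shows "exp_rare z B A'"
proof -
  obtain C c where "0 < c"
    "\<forall>\<^sub>F n in sequentially. real (card (A n)) \<le> C * exp (- c / z n) * real (card (B n))"
    using assms(1) unfolding exp_rare_def by blast
  moreover from this(2) assms(2) have
    "\<forall>\<^sub>F n in sequentially. real (card (A' n)) \<le> C * exp (- c / z n) * real (card (B n))"
    by eventually_elim linarith
  ultimately show ?thesis unfolding exp_rare_def by blast
qed

lemma floor_step_tendsto:
  assumes "(z \<longlongrightarrow> 0) F" "\<forall>\<^sub>F n in F. 0 < (z n :: real)" "0 \<le> t"
  shows "((\<lambda>n. z n * real (nat \<lfloor>t / z n\<rfloor>)) \<longlongrightarrow> t) F"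
proof (rule tendsto_sandwich)
  have ev: "\<forall>\<^sub>F n in F. t - z n \<le> z n * real (nat \<lfloor>t / z n\<rfloor>) \<and> z n * real (nat \<lfloor>t / z n\<rfloor>) \<le> t"
    using assms(2)
  proof eventually_elim
    case (elim n)
    then have "real (nat \<lfloor>t / z n\<rfloor>) = of_int \<lfloor>t / z n\<rfloor>" using assms(3) by simp
    moreover have "of_int \<lfloor>t / z n\<rfloor> \<le> t / z n" "t / z n - 1 \<le> of_int \<lfloor>t / z n\<rfloor>" by linarith+
    ultimately have x: "real (nat \<lfloor>t / z n\<rfloor>) \<le> t / z n" "t / z n - 1 \<le> real (nat \<lfloor>t / z n\<rfloor>)"
      by simp_all
    from mult_left_mono[OF x(1), of "z n"] mult_left_mono[OF x(2), of "z n"] elim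
    show ?case by (simp add: right_diff_distrib)
  qed
  show "\<forall>\<^sub>F n in F. t - z n \<le> z n * real (nat \<lfloor>t / z n\<rfloor>)"
    "\<forall>\<^sub>F n in F. z n * real (nat \<lfloor>t / z n\<rfloor>) \<le> t"
    using ev by (auto elim: eventually_mono)
  show "((\<lambda>n. t - z n) \<longlongrightarrow> t) F" using tendsto_diff[OF tendsto_const assms(1), of t] by simp
qed auto

text \<open>A common frame for the two regimes. The tilt \<open>z n\<close> is asymptotically critical:
  \<open>m_tendsto\<close> says that the prescribed weight \<open>m n\<close> agrees to leading order with the tilted mean
  weight, which is \<open>dilog_exp (z n * k n) / (z n)\<^sup>2\<close> up to lower order. The values
  \<open>dilog_lim a\<close> are \<open>dilog_exp (a * T)\<close> if \<open>z n * k n\<close> tends to a finite \<open>T\<close>, and the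
  constant \<open>pi\<^sup>2 / 6\<close> if it tends to infinity.\<close>

locale tilted_scaling =
  fixes k m :: "nat \<Rightarrow> nat" and z :: "nat \<Rightarrow> real"
    and dilog_lim :: "real \<Rightarrow> real"
  assumes k_pos: "0 < k n"
    and z_pos: "\<forall>\<^sub>F n in sequentially. 0 < z n"
    and z_tendsto: "z \<longlonglongrightarrow> 0"
    and m_tendsto: "(\<lambda>n. (z n)\<^sup>2 * real (m n)) \<longlonglongrightarrow> dilog_lim 1"
    and dilog_tendsto:
      "0 < a \<Longrightarrow> (\<lambda>n. dilog_exp (a * (z n * real (k n)))) \<longlonglongrightarrow> dilog_lim a"
    and dilog_lim_pos: "0 < a \<Longrightarrow> 0 < dilog_lim a"
    and dilog_lim_cont: "isCont dilog_lim 1"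
    and dilog_lim_less: "1 < a \<Longrightarrow> dilog_lim a / a\<^sup>2 < dilog_lim 1"
begin

lemma inverse_z_at_top:
  assumes "0 < c"
  shows "filterlim (\<lambda>n. c / z n) at_top sequentially"
proof -
  have "filterlim z (at_right 0) sequentially"
    using z_tendsto z_pos by (auto simp: filterlim_at elim: eventually_mono)
  then have "filterlim (\<lambda>n. inverse (z n)) at_top sequentially"
    using filterlim_compose[OF filterlim_inverse_at_top_right] by blast
  then have "filterlim (\<lambda>n. c * inverse (z n)) at_top sequentially"
    using assms filterlim_tendsto_pos_mult_at_top[OF tendsto_const] by blast
  then show ?thesis by (simp add: divide_inverse)
qed

text \<open>This absorbs the factor that \<open>card_configs_lower_bound\<close> loses, since \<open>m\<close> is only of order
  \<open>1 / z\<^sup>2\<close>.\<close>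

lemma polynomial_factor_negligible:
  assumes "0 < c"
  shows "\<forall>\<^sub>F n in sequentially. 4 * real (Suc (m n)) \<le> exp (c / z n)"
proof -
  define C where "C = 4 * (dilog_lim 1 + 1)"
  have C: "0 < C" using dilog_lim_pos[of 1] by (simp add: C_def)
  have "(\<lambda>n. 4 * ((z n)\<^sup>2 * real (m n) + (z n)\<^sup>2)) \<longlonglongrightarrow> 4 * (dilog_lim 1 + 0\<^sup>2)"
    by (intro tendsto_intros m_tendsto z_tendsto)
  then have 1: "\<forall>\<^sub>F n in sequentially. 4 * ((z n)\<^sup>2 * real (m n) + (z n)\<^sup>2) < C"
    by (rule order_tendstoD) (simp add: C_def)
  have "((\<lambda>x::real. x ^ 2 / exp x) \<longlongrightarrow> 0) at_top" by (rule tendsto_power_div_exp_0)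
  from filterlim_compose[OF this inverse_z_at_top[OF assms]]
  have "\<forall>\<^sub>F n in sequentially. (c / z n) ^ 2 / exp (c / z n) < c\<^sup>2 / C"
    by (rule order_tendstoD) (use assms C in simp)
  then show ?thesis using 1 z_pos
  proof eventually_elim
    case (elim n)
    have "4 * real (Suc (m n)) \<le> C / (z n)\<^sup>2"
      using elim(2,3) by (simp add: field_simps)
    also have "\<dots> \<le> exp (c / z n)"
      using elim(1,3) assms C by (simp add: field_simps)
    finally show ?case .
  qed
qed

text \<open>With tilts \<open>a z\<close> slightly larger than the critical \<open>z\<close>, almost all of the tilted mass
  sits on weights just below \<open>m\<close>, because the tilted mean weight is close to
  \<open>dilog_lim a / (a z)\<^sup>2\<close>. The loss \<open>\<eta> / z\<close> in the exponent vanishes as \<open>a\<close> tends to 1.\<close>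

lemma card_configs_asymptotic_lower_bound:
  assumes "0 < \<eta>"
  shows "\<forall>\<^sub>F a in at_right 1. \<forall>\<^sub>F n in sequentially.
    exp (log_gf (k n) (a * z n) + a * z n * real (m n))
      \<le> exp (\<eta> / z n) * real (card (configs (k n) (m n)))"
proof -
  define \<kappa> where "\<kappa> a = dilog_lim (2 * a - 1) / ((2 * a - 1)\<^sup>2 * a)" for a
  have "((\<lambda>a. dilog_lim (2 * a - 1)) \<longlongrightarrow> dilog_lim 1) (at_right 1)"
  proof (rule isCont_tendsto_compose[OF dilog_lim_cont])
    have "((\<lambda>a. 2 * a - 1 :: real) \<longlongrightarrow> 2 * 1 - 1) (at_right 1)" by (intro tendsto_intros)
    then show "((\<lambda>a. 2 * a - 1 :: real) \<longlongrightarrow> 1) (at_right 1)" by simp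
  qed
  then have "((\<lambda>a. a * (dilog_lim 1 - \<kappa> a)) \<longlongrightarrow> 1 * (dilog_lim 1 - dilog_lim 1 / ((2 * 1 - 1)\<^sup>2 * 1)))
      (at_right 1)"
    unfolding \<kappa>_def by (intro tendsto_intros) auto
  then have "\<forall>\<^sub>F a in at_right 1. a * (dilog_lim 1 - \<kappa> a) < \<eta> / 2"
    by (rule order_tendstoD) (use assms in simp)
  moreover have "\<forall>\<^sub>F a :: real in at_right 1. 1 < a" by (rule eventually_at_right_less)
  ultimately show ?thesis
  proof eventually_elim
    case (elim a)
    \<comment> \<open>The three tilts of the counting bound are \<open>b z < a z < c z\<close>. The lower end \<open>m'\<close> of the weight
       window is \<open>\<kappa> a / z\<^sup>2\<close>, where \<open>\<kappa> a\<close> is kept strictly below the limit of \<open>z\<^sup>2\<close> times the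
       mean weight at \<open>c z\<close>.\<close>
    define b c where "b = (1 + a) / 2" and "c = 2 * a - 1"
    have ab: "1 < b" "b < a" "a < c" using elim by (auto simp: b_def c_def)
    have \<kappa>: "0 < \<kappa> a" "\<kappa> a < dilog_lim c / c\<^sup>2"
      using dilog_lim_pos[of c] ab elim
      by (auto simp: \<kappa>_def c_def[symmetric] intro!: divide_strict_left_mono mult_pos_pos)
    define m' where "m' n = nat \<lfloor>\<kappa> a / (z n)\<^sup>2\<rfloor>" for n
    define d1 d2 where "d1 = (dilog_lim 1 - dilog_lim b / b\<^sup>2) / 2"
      and "d2 = (dilog_lim c / c\<^sup>2 - \<kappa> a) / 2"
    have d: "0 < d1" "0 < d2" using dilog_lim_less[OF ab(1)] \<kappa> unfolding d1_def d2_def by simp_all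
    have "(\<lambda>n. (z n)\<^sup>2 * real (m n) - dilog_exp (b * (z n * real (k n))) / b\<^sup>2)
        \<longlonglongrightarrow> dilog_lim 1 - dilog_lim b / b\<^sup>2"
      using ab by (intro tendsto_intros m_tendsto dilog_tendsto) auto
    then have 1: "\<forall>\<^sub>F n in sequentially.
        d1 < (z n)\<^sup>2 * real (m n) - dilog_exp (b * (z n * real (k n))) / b\<^sup>2"
      by (rule order_tendstoD) (use d in \<open>auto simp: d1_def\<close>)
    have d2: "d2 < dilog_lim c / c\<^sup>2 - \<kappa> a" 
    proof -
      have "dilog_lim c / c\<^sup>2 - \<kappa> a = 2 * d2" unfolding d2_def by simp
      then show ?thesis using d(2) by (simp only:)
    qed
    have "(\<lambda>n. (dilog_exp (c * (z n * real (k n))) - c * z n) / c\<^sup>2 - \<kappa> a)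
        \<longlonglongrightarrow> (dilog_lim c - c * 0) / c\<^sup>2 - \<kappa> a"
      using ab by (intro tendsto_intros z_tendsto dilog_tendsto) auto
    then have 2: "\<forall>\<^sub>F n in sequentially.
        d2 < (dilog_exp (c * (z n * real (k n))) - c * z n) / c\<^sup>2 - \<kappa> a"
      by (rule order_tendstoD) (use d2 in simp)
    have "(\<lambda>n. a * ((z n)\<^sup>2 * real (m n) - \<kappa> a + (z n)\<^sup>2)) \<longlonglongrightarrow> a * (dilog_lim 1 - \<kappa> a + 0\<^sup>2)"
      by (intro tendsto_intros m_tendsto z_tendsto)
    then have 3: "\<forall>\<^sub>F n in sequentially. a * ((z n)\<^sup>2 * real (m n) - \<kappa> a + (z n)\<^sup>2) < \<eta> / 2"
      by (rule order_tendstoD) (use elim in simp)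
    have 4: "\<forall>\<^sub>F n in sequentially. ln 4 \<le> ((a - b) * d1) / z n"
      "\<forall>\<^sub>F n in sequentially. ln 4 \<le> ((c - a) * d2) / z n"
      using inverse_z_at_top[of "(a - b) * d1"] inverse_z_at_top[of "(c - a) * d2"] ab d
      by (auto simp: filterlim_at_top)
    have 5: "\<forall>\<^sub>F n in sequentially. 4 * real (Suc (m n)) \<le> exp ((\<eta> / 2) / z n)"
      using assms by (intro polynomial_factor_negligible) simp
    show ?case using 1 2 3 4 5 z_pos
    proof eventually_elim
      case (elim n)
      define w where "w = z n"
      have w: "0 < w" using elim by (simp add: w_def)
      have rescale: "(p - q) / w * (w\<^sup>2 * x) = (p * w - q * w) * x" for p q x
      proof -
        have "(p - q) / w * (w\<^sup>2 * x) = ((p - q) / w * w) * w * x"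
          by (simp only: power2_eq_square mult.assoc)
        also have "(p - q) / w * w = p - q" using w by simp
        finally show ?thesis by (simp only: left_diff_distrib)
      qed
      have "(w * b)\<^sup>2 * mean_weight (k n) (b * w) \<le> dilog_exp (b * w * real (k n))"
        using mean_weight_le[of "b * w" "k n"] w ab by (simp add: mult.commute)
      then have "w\<^sup>2 * mean_weight (k n) (b * w) \<le> dilog_exp (b * (w * real (k n))) / b\<^sup>2"
        using ab by (simp add: field_simps power_mult_distrib)
      then have "d1 < w\<^sup>2 * (real (m n) - mean_weight (k n) (b * w))"
        using elim(1) by (simp add: w_def algebra_simps)
      also have "\<dots> \<le> w\<^sup>2 * (real (Suc (m n)) - mean_weight (k n) (b * w))"
        by (intro mult_left_mono) auto
      finally have "(a - b) / w * d1 \<le> (a - b) / w * (w\<^sup>2 * (real (Suc (m n)) - mean_weight (k n) (b * w)))"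
        using ab w by (intro mult_left_mono) auto
      then have hi: "ln 4 \<le> (a * w - b * w) * (real (Suc (m n)) - mean_weight (k n) (b * w))"
        unfolding rescale unfolding times_divide_eq_left by (rule order_trans[OF elim(4)[folded w_def]])
      have "real (m' n) \<le> \<kappa> a / w\<^sup>2"
        using \<kappa> w unfolding m'_def w_def[symmetric] by (simp add: of_nat_floor)
      then have m': "w\<^sup>2 * real (m' n) \<le> \<kappa> a" using w by (simp add: field_simps)
      have "\<kappa> a / w\<^sup>2 - 1 \<le> real (m' n)" unfolding m'_def w_def[symmetric] by linarith
      then have m'_ge: "\<kappa> a - w\<^sup>2 \<le> w\<^sup>2 * real (m' n)" using w by (simp add: field_simps)
      have "dilog_exp (c * w * real (k n)) - c * w \<le> (w * c)\<^sup>2 * mean_weight (k n) (c * w)"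
        using mean_weight_ge[of "c * w" "k n"] w ab by (simp add: mult.commute)
      then have "(dilog_exp (c * (w * real (k n))) - c * w) / c\<^sup>2 \<le> w\<^sup>2 * mean_weight (k n) (c * w)"
        using ab by (simp add: field_simps power_mult_distrib)
      then have "d2 < w\<^sup>2 * (mean_weight (k n) (c * w) - real (m' n))"
        using elim(2) m' by (simp add: w_def[symmetric] right_diff_distrib)
      then have "(c - a) / w * d2 \<le> (c - a) / w * (w\<^sup>2 * (mean_weight (k n) (c * w) - real (m' n)))"
        using ab w by (intro mult_left_mono) auto
      then have lo: "ln 4 \<le> (c * w - a * w) * (mean_weight (k n) (c * w) - real (m' n))"
        unfolding rescale unfolding times_divide_eq_left by (rule order_trans[OF elim(5)[folded w_def]])
      have "exp (log_gf (k n) (a * w))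
          \<le> 4 * real (Suc (m n)) * exp (- (a * w) * real (m' n)) * real (card (configs (k n) (m n)))"
        by (rule card_configs_lower_bound[OF k_pos _ _ _ hi lo]) (use w ab in auto)
      then have "exp (log_gf (k n) (a * w)) * exp (a * w * real (m n))
          \<le> 4 * real (Suc (m n)) * exp (- (a * w) * real (m' n)) * real (card (configs (k n) (m n)))
              * exp (a * w * real (m n))"
        by (intro mult_right_mono) auto
      also have "\<dots> = 4 * real (Suc (m n)) * (exp (a * w * (real (m n) - real (m' n)))
          * real (card (configs (k n) (m n))))"
        by (simp add: right_diff_distrib exp_diff exp_minus field_simps)
      also have "\<dots> \<le> exp ((\<eta> / 2) / w) * (exp ((\<eta> / 2) / w) * real (card (configs (k n) (m n))))"
      proof (intro mult_mono)
        have "a * (w\<^sup>2 * real (m n) - w\<^sup>2 * real (m' n)) \<le> a * (w\<^sup>2 * real (m n) - \<kappa> a + w\<^sup>2)"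
          using m'_ge ab by (intro mult_left_mono) auto
        then have "a * (w\<^sup>2 * real (m n) - w\<^sup>2 * real (m' n)) \<le> \<eta> / 2"
          using elim(3) by (simp add: w_def)
        then have "a * w * (real (m n) - real (m' n)) \<le> (\<eta> / 2) / w"
          using w by (simp add: field_simps power2_eq_square)
        then show "exp (a * w * (real (m n) - real (m' n))) \<le> exp ((\<eta> / 2) / w)" by simp
      qed (use elim in \<open>auto simp: w_def\<close>)
      also have "\<dots> = exp (\<eta> / w) * real (card (configs (k n) (m n)))"
        by (simp only: mult.assoc[symmetric] exp_add[symmetric]) simp
      finally show ?case by (simp add: w_def exp_add)
    qed
  qed
qed

lemma eventually_card_configs_pos: "\<forall>\<^sub>F n in sequentially. 0 < card (configs (k n) (m n))"
proof -
  from card_configs_asymptotic_lower_bound[of 1] obtain a where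
    "\<forall>\<^sub>F n in sequentially. exp (log_gf (k n) (a * z n) + a * z n * real (m n))
      \<le> exp (1 / z n) * real (card (configs (k n) (m n)))"
    using eventually_happens[of _ "at_right (1::real)"] by fastforce
  then show ?thesis
  proof eventually_elim
    case (elim n)
    have "0 < exp (log_gf (k n) (a * z n) + a * z n * real (m n))" by simp
    with elim have "0 < exp (1 / z n) * real (card (configs (k n) (m n)))" by linarith
    then show ?case by (simp add: zero_less_mult_iff)
  qed
qed

end

text \<open>The rescaled position \<open>t\<close> must lie below the limit of \<open>z n * k n\<close>. The values \<open>shape_lim a s\<close> are
  \<open>limit_shape_inf (a * T - s)\<close> for finite \<open>T\<close>, and zero when \<open>T\<close> is infinite.\<close>

locale tilted_scaling_point = tilted_scaling +
  fixes t :: real and shape_lim :: "real \<Rightarrow> real \<Rightarrow> real"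
  assumes t_pos: "0 < t"
    and t_le: "\<forall>\<^sub>F n in sequentially. t \<le> z n * real (k n)"
    and shape_tendsto: "1 < a \<Longrightarrow> \<bar>s\<bar> < t \<Longrightarrow>
      (\<lambda>n. limit_shape_inf (a * (z n * real (k n)) - s)) \<longlonglongrightarrow> shape_lim a s"
    and shape_lim_cont1: "\<bar>s\<bar> < t \<Longrightarrow> ((\<lambda>a. shape_lim a s) \<longlongrightarrow> shape_lim 1 s) (at_right 1)"
    and shape_lim_cont2: "(shape_lim 1 \<longlongrightarrow> shape_lim 1 0) (at 0)"
begin

definition tail :: "nat \<Rightarrow> (nat \<Rightarrow> nat) \<Rightarrow> real" where
  "tail n D = real (\<Sum>j\<in>{nat \<lfloor>t / z n\<rfloor>..<k n}. D j)"

text \<open>The counting bound at tilt \<open>a z\<close>, divided by the lower bound on the number of configurations. The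
  rescaled exponent tends to \<open>\<eta> + s * (X - \<phi>) - r * \<epsilon>\<close>, where \<open>X\<close> is close to \<open>\<phi>\<close> for small \<open>s\<close>
  and \<open>a\<close> near 1. The linear term \<open>r * \<epsilon>\<close> with \<open>r = \<bar>s\<bar>\<close> therefore wins once \<open>s\<close> is fixed first, and
  then \<open>\<eta> = r * \<epsilon> / 4\<close> and \<open>a\<close>. The sign \<open>\<sigma>\<close> of \<open>s\<close> selects the direction of the deviation.\<close>

lemma one_sided_tail_deviation_rare:
  assumes "0 < \<epsilon>" and \<sigma>: "\<sigma> = 1 \<or> \<sigma> = -1"
  defines "\<phi> \<equiv> limit_shape_inf t - shape_lim 1 0"
  shows "exp_rare z (\<lambda>n. configs (k n) (m n))
    (\<lambda>n. {D \<in> configs (k n) (m n). \<epsilon> \<le> \<sigma> * (z n * tail n D - \<phi>)})"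
proof -
  have "((\<lambda>s. limit_shape_inf (t - s) - shape_lim 1 s) \<longlongrightarrow> \<phi>) (at 0)"
    unfolding \<phi>_def
  proof (intro tendsto_diff shape_lim_cont2 isCont_tendsto_compose[OF isCont_shape[OF t_pos]])
    have "((\<lambda>s. t - s) \<longlongrightarrow> t - 0) (at 0)" by (intro tendsto_intros)
    then show "((\<lambda>s. t - s) \<longlongrightarrow> t) (at 0)" by simp
  qed
  then obtain d where d: "0 < d" "\<And>s. s \<noteq> 0 \<Longrightarrow> \<bar>s\<bar> < d \<Longrightarrow>
      \<bar>limit_shape_inf (t - s) - shape_lim 1 s - \<phi>\<bar> < \<epsilon> / 4"
    unfolding LIM_def using assms(1) by (metis diff_zero dist_real_def zero_less_divide_iff zero_less_numeral)
  define r where "r = min d t / 2"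
  define s where "s = \<sigma> * r"
  have r: "0 < r" "r < t" "r < d" using d t_pos by (auto simp: r_def)
  have s: "s \<noteq> 0" "\<bar>s\<bar> < t" "\<bar>s\<bar> = r" "s < t" "\<bar>s\<bar> < d"
    using r \<sigma> by (auto simp: s_def)
  have close: "\<bar>limit_shape_inf (t - s) - shape_lim 1 s - \<phi>\<bar> < \<epsilon> / 4" using d(2) s by auto
  have at_lim: "((\<lambda>a. (limit_shape_inf (a * t - s) - shape_lim a s) / a - \<phi>)
      \<longlongrightarrow> (limit_shape_inf (t - s) - shape_lim 1 s) / 1 - \<phi>) (at_right 1)"
  proof -
    have "((\<lambda>a. a * t - s) \<longlongrightarrow> 1 * t - s) (at_right 1)" by (intro tendsto_intros)
    then have "((\<lambda>a. a * t - s) \<longlongrightarrow> t - s) (at_right 1)" by simp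
    then have "((\<lambda>a. limit_shape_inf (a * t - s)) \<longlongrightarrow> limit_shape_inf (t - s)) (at_right 1)"
      using s by (intro isCont_tendsto_compose[OF isCont_shape]) auto
    then show ?thesis using s by (intro tendsto_intros shape_lim_cont1) auto
  qed
  have "\<forall>\<^sub>F a in at_right 1. \<bar>(limit_shape_inf (a * t - s) - shape_lim a s) / a - \<phi>\<bar> < \<epsilon> / 2"
    using order_tendstoD(2)[OF tendsto_rabs[OF at_lim], of "\<epsilon> / 2"] close assms(1) by simp
  moreover have "\<forall>\<^sub>F a in at_right 1. \<forall>\<^sub>F n in sequentially.
      exp (log_gf (k n) (a * z n) + a * z n * real (m n))
        \<le> exp (r * \<epsilon> / 4 / z n) * real (card (configs (k n) (m n)))"
    using r assms(1) by (intro card_configs_asymptotic_lower_bound) auto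
  moreover have "\<forall>\<^sub>F a :: real in at_right 1. 1 < a" by (rule eventually_at_right_less)
  ultimately have "\<forall>\<^sub>F a in at_right 1. 1 < a \<and>
      \<bar>(limit_shape_inf (a * t - s) - shape_lim a s) / a - \<phi>\<bar> < \<epsilon> / 2 \<and>
      (\<forall>\<^sub>F n in sequentially. exp (log_gf (k n) (a * z n) + a * z n * real (m n))
        \<le> exp (r * \<epsilon> / 4 / z n) * real (card (configs (k n) (m n))))"
    by eventually_elim blast
  then obtain a where a: "1 < a"
    and a1: "\<bar>(limit_shape_inf (a * t - s) - shape_lim a s) / a - \<phi>\<bar> < \<epsilon> / 2"
    and a2: "\<forall>\<^sub>F n in sequentially. exp (log_gf (k n) (a * z n) + a * z n * real (m n))
        \<le> exp (r * \<epsilon> / 4 / z n) * real (card (configs (k n) (m n)))"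
    using eventually_happens[of _ "at_right (1::real)"] by fastforce
  define j0 where "j0 n = nat \<lfloor>t / z n\<rfloor>" for n
  have j0_lim: "(\<lambda>n. z n * real (j0 n)) \<longlonglongrightarrow> t"
    unfolding j0_def using z_tendsto z_pos t_pos by (intro floor_step_tendsto) auto
  have at: "t < a * t" using a t_pos by simp
  define e where "e n = (if 0 \<le> s then j0 n else Suc (j0 n))" for n
  have e_lim: "(\<lambda>n. z n * real (e n)) \<longlonglongrightarrow> t"
  proof (cases "0 \<le> s")
    case False
    have "(\<lambda>n. z n * real (j0 n) + z n) \<longlonglongrightarrow> t + 0" by (intro tendsto_intros j0_lim z_tendsto)
    then show ?thesis using False by (simp add: e_def algebra_simps)
  qed (use j0_lim in \<open>simp add: e_def\<close>)
  have "(\<lambda>n. limit_shape_inf (a * (z n * real (e n)) - s)) \<longlonglongrightarrow> limit_shape_inf (a * t - s)"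
    using s at by (intro isCont_tendsto_compose[OF isCont_shape] tendsto_intros e_lim) auto
  then have "(\<lambda>n. r * \<epsilon> / 4 - (s * \<phi> + r * \<epsilon>) + s * (limit_shape_inf (a * (z n * real (e n)) - s)
        - limit_shape_inf (a * (z n * real (k n)) - s)) / a)
      \<longlonglongrightarrow> r * \<epsilon> / 4 - (s * \<phi> + r * \<epsilon>) + s * (limit_shape_inf (a * t - s) - shape_lim a s) / a"
    using s a by (intro tendsto_intros shape_tendsto) auto
  moreover have "r * \<epsilon> / 4 - (s * \<phi> + r * \<epsilon>) + s * (limit_shape_inf (a * t - s) - shape_lim a s) / a
      < - (r * \<epsilon> / 4)"
  proof -
    define X where "X = (limit_shape_inf (a * t - s) - shape_lim a s) / a - \<phi>"
    have "s * X \<le> r * \<bar>X\<bar>" using s(3) by (metis abs_ge_self abs_mult)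
    also have "\<dots> < r * (\<epsilon> / 2)" using a1 r by (intro mult_strict_left_mono) (auto simp: X_def)
    finally have "s * X < r * (\<epsilon> / 2)" .
    moreover have "s * (limit_shape_inf (a * t - s) - shape_lim a s) / a = s * X + s * \<phi>"
      by (simp add: X_def right_diff_distrib)
    ultimately show ?thesis by (simp add: mult.commute[of \<epsilon> r])
  qed
  ultimately have ev: "\<forall>\<^sub>F n in sequentially.
      r * \<epsilon> / 4 - (s * \<phi> + r * \<epsilon>) + s * (limit_shape_inf (a * (z n * real (e n)) - s)
        - limit_shape_inf (a * (z n * real (k n)) - s)) / a < - (r * \<epsilon> / 4)"
    by (rule order_tendstoD)
  have "(\<lambda>n. a * (z n * real (j0 n))) \<longlonglongrightarrow> a * t" by (intro tendsto_intros j0_lim)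
  then have evs: "\<forall>\<^sub>F n in sequentially. s < a * (z n * real (j0 n))"
    by (rule order_tendstoD) (use s at in simp)
  have "\<forall>\<^sub>F n in sequentially. real (card {D \<in> configs (k n) (m n). \<epsilon> \<le> \<sigma> * (z n * tail n D - \<phi>)})
      \<le> 1 * exp (- (r * \<epsilon> / 4) / z n) * real (card (configs (k n) (m n)))"
    using ev evs a2 z_pos t_le
  proof eventually_elim
    case (elim n)
    define w where "w = a * z n"
    define c where "c = (s * \<phi> + r * \<epsilon>) / z n"
    define \<Sigma> where "\<Sigma> = s * (\<Sum>j\<in>{j0 n..<k n}. bose (w * real (Suc j) - s))"
    have zn: "0 < z n" and w: "0 < w" using elim a by (auto simp: w_def)
    have "t / z n \<le> real (k n)" using elim by (simp add: field_simps)
    then have j0k: "j0 n \<le> k n" unfolding j0_def by linarith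
    have sw: "s < w * real (j0 n)" using elim by (simp add: w_def mult.assoc)
    have "{D \<in> configs (k n) (m n). \<epsilon> \<le> \<sigma> * (z n * tail n D - \<phi>)}
        \<subseteq> {D \<in> configs (k n) (m n). c \<le> s * real (\<Sum>j\<in>{j0 n..<k n}. D j)}"
    proof clarify
      fix D assume "\<epsilon> \<le> \<sigma> * (z n * tail n D - \<phi>)"
      then have "r * \<epsilon> \<le> r * (\<sigma> * (z n * tail n D - \<phi>))" using r by (intro mult_left_mono) auto
      then have "s * \<phi> + r * \<epsilon> \<le> s * tail n D * z n" by (simp add: s_def algebra_simps)
      then show "c \<le> s * real (\<Sum>j\<in>{j0 n..<k n}. D j)"
        using zn by (simp add: c_def tail_def j0_def pos_divide_le_eq)
    qed
    then have "real (card {D \<in> configs (k n) (m n). \<epsilon> \<le> \<sigma> * (z n * tail n D - \<phi>)})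
        \<le> real (card {D \<in> configs (k n) (m n). c \<le> s * real (\<Sum>j\<in>{j0 n..<k n}. D j)})"
      using finite_configs by (simp add: card_mono)
    also have "\<dots> \<le> exp (w * real (m n) - c + log_gf (k n) w + \<Sigma>)"
      unfolding \<Sigma>_def
    proof (rule card_configs_tail_le[OF w])
      fix j assume "j0 n \<le> j"
      then have "w * real (j0 n) \<le> w * real (Suc j)" using w by simp
      then show "s < w * real (Suc j)" using sw by linarith
    qed
    also have "\<dots> = exp (log_gf (k n) (a * z n) + a * z n * real (m n)) * exp (\<Sigma> - c)"
      by (simp add: w_def flip: exp_add)
    also have "\<dots> \<le> exp (r * \<epsilon> / 4 / z n) * real (card (configs (k n) (m n))) * exp (\<Sigma> - c)"
      using elim(3) by (intro mult_right_mono) auto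
    also have "\<dots> = exp (r * \<epsilon> / 4 / z n + \<Sigma> - c) * real (card (configs (k n) (m n)))"
      by (simp add: exp_diff exp_add)
    also have "\<dots> \<le> exp (- (r * \<epsilon> / 4) / z n) * real (card (configs (k n) (m n)))"
    proof -
      have "w * \<Sigma> \<le> s * (limit_shape_inf (a * (z n * real (e n)) - s)
          - limit_shape_inf (a * (z n * real (k n)) - s))"
        using bose_sum_tilted[OF w j0k sw]
        by (simp add: \<Sigma>_def e_def w_def mult.assoc mult.left_commute cong: if_cong)
      then have "z n * \<Sigma> \<le> s * (limit_shape_inf (a * (z n * real (e n)) - s)
          - limit_shape_inf (a * (z n * real (k n)) - s)) / a"
        using a by (simp add: w_def pos_le_divide_eq mult_ac)
      then have "r * \<epsilon> / 4 + z n * \<Sigma> - (s * \<phi> + r * \<epsilon>) \<le> - (r * \<epsilon> / 4)"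
        using elim(1) by linarith
      then have "(r * \<epsilon> / 4 + z n * \<Sigma> - (s * \<phi> + r * \<epsilon>)) / z n \<le> - (r * \<epsilon> / 4) / z n"
        using zn by (intro divide_right_mono) auto
      moreover have "(r * \<epsilon> / 4 + z n * \<Sigma> - (s * \<phi> + r * \<epsilon>)) / z n = r * \<epsilon> / 4 / z n + \<Sigma> - c"
        using zn by (simp add: c_def add_divide_distrib diff_divide_distrib)
      ultimately show ?thesis by (intro mult_right_mono) auto
    qed
    finally show ?case by simp
  qed
  moreover have "0 < r * \<epsilon> / 4" using r assms(1) by simp
  ultimately show ?thesis unfolding exp_rare_def by blast
qed

lemma tail_deviation_rare:
  assumes "0 < \<epsilon>"
  shows "exp_rare z (\<lambda>n. configs (k n) (m n)) (\<lambda>n. {D \<in> configs (k n) (m n).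
    \<epsilon> \<le> \<bar>z n * tail n D - (limit_shape_inf t - shape_lim 1 0)\<bar>})"
proof -
  have "{D \<in> configs (k n) (m n). \<epsilon> \<le> \<bar>z n * tail n D - (limit_shape_inf t - shape_lim 1 0)\<bar>}
    = {D \<in> configs (k n) (m n). \<epsilon> \<le> 1 * (z n * tail n D - (limit_shape_inf t - shape_lim 1 0))}
    \<union> {D \<in> configs (k n) (m n). \<epsilon> \<le> -1 * (z n * tail n D - (limit_shape_inf t - shape_lim 1 0))}" for n
    using assms by (auto simp: abs_if)
  then show ?thesis
    using exp_rare_Un[OF one_sided_tail_deviation_rare[OF assms, of 1]
        one_sided_tail_deviation_rare[OF assms, of "-1"] z_pos] by simp
qed

end

section \<open>Gap partitions as configurations\<close>

definition partition_of :: "(nat \<Rightarrow> nat) \<Rightarrow> nat \<Rightarrow> (nat \<Rightarrow> nat) \<Rightarrow> nat \<Rightarrow> nat" where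
  "partition_of qs k D i = (\<Sum>j\<in>{i..<k}. D j + qs (k - Suc j))"

text \<open>The weight of the smallest admissible partition with \<open>k\<close> parts, in which every difference is
  minimal.\<close>

definition min_weight :: "(nat \<Rightarrow> nat) \<Rightarrow> nat \<Rightarrow> nat" where
  "min_weight qs k = (\<Sum>j<k. Suc j * qs (k - Suc j))"

lemma sum_tails: "(\<Sum>i<k. \<Sum>j\<in>{i..<k}. d j) = (\<Sum>j<k. Suc j * d j)" for d :: "nat \<Rightarrow> nat"
proof (induction k)
  case (Suc k)
  have "(\<Sum>i<Suc k. \<Sum>j\<in>{i..<Suc k}. d j) = (\<Sum>i<Suc k. (\<Sum>j\<in>{i..<k}. d j) + d k)"
    by (rule sum.cong) auto
  also have "\<dots> = (\<Sum>i<k. \<Sum>j\<in>{i..<k}. d j) + Suc k * d k" by (simp add: sum.distrib)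
  finally show ?case using Suc by simp
qed simp

lemma sum_gaps_shift: "(\<Sum>j\<in>{i..<k}. qs (k - Suc j)) = (\<Sum>l<k - i. qs l)" for qs :: "nat \<Rightarrow> nat"
  by (rule sum.reindex_bij_witness[of _ "\<lambda>l. k - Suc l" "\<lambda>j. k - Suc j"]) auto

lemma min_weight_eq: "min_weight qs k = (\<Sum>i<k. \<Sum>l<Suc i. qs l)"
proof -
  have "min_weight qs k = (\<Sum>i<k. \<Sum>j\<in>{i..<k}. qs (k - Suc j))"
    by (simp add: min_weight_def sum_tails)
  also have "\<dots> = (\<Sum>i<k. \<Sum>l<k - i. qs l)" by (simp only: sum_gaps_shift)
  also have "\<dots> = (\<Sum>i<k. \<Sum>l<Suc i. qs l)"
    by (rule sum.reindex_bij_witness[of _ "\<lambda>i. k - Suc i" "\<lambda>i. k - Suc i"])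
      (auto simp del: sum.lessThan_Suc simp: Suc_diff_Suc)
  finally show ?thesis .
qed

lemma partition_of_eq:
  "partition_of qs k D i = (\<Sum>j\<in>{i..<k}. D j) + (\<Sum>l<k - i. qs l)"
  by (simp add: partition_of_def sum.distrib sum_gaps_shift)

lemma partition_of_Suc:
  "i < k \<Longrightarrow> partition_of qs k D i = D i + qs (k - Suc i) + partition_of qs k D (Suc i)"
  by (simp add: partition_of_def sum.atLeast_Suc_lessThan)

lemma partition_of_support:
  assumes "gap_sequence qs"
  shows "{i. 0 < partition_of qs k D i} = {..<k}"
proof -
  have "0 < partition_of qs k D i" if "i < k" for i
  proof -
    have "qs (k - Suc (k - 1)) \<le> partition_of qs k D i"
      unfolding partition_of_def using that
      by (intro order_trans[OF _ member_le_sum[of "k - 1"]]) auto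
    then show ?thesis using assms that by (simp add: gap_sequence_def)
  qed
  moreover have "partition_of qs k D i = 0" if "\<not> i < k" for i
    using that by (simp add: partition_of_def)
  ultimately show ?thesis by force
qed

lemma weight_partition_of:
  assumes "gap_sequence qs"
  shows "weight (partition_of qs k D) = (\<Sum>j<k. Suc j * D j) + min_weight qs k"
proof -
  have "weight (partition_of qs k D) = (\<Sum>i<k. partition_of qs k D i)"
    using partition_of_support[OF assms, of k D] by (simp add: weight_def)
  also have "\<dots> = (\<Sum>j<k. Suc j * (D j + qs (k - Suc j)))"
    unfolding partition_of_def by (rule sum_tails)
  finally show ?thesis by (simp add: min_weight_def sum.distrib algebra_simps)
qed

lemma partition_of_in_gap_partitions:
  assumes "gap_sequence qs"
  shows "partition_of qs k D \<in> gap_partitions qs" "num_parts (partition_of qs k D) = k"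
proof -
  show n: "num_parts (partition_of qs k D) = k"
    using partition_of_support[OF assms, of k D] by (simp add: num_parts_def)
  have "antimono (partition_of qs k D)"
    unfolding antimono_def partition_of_def by (auto intro!: sum_mono2)
  then show "partition_of qs k D \<in> gap_partitions qs"
    using partition_of_support[OF assms, of k D]
    by (auto simp: gap_partitions_def is_partition_def n partition_of_Suc)
qed

lemma partition_support:
  assumes "is_partition lam"
  shows "{i. 0 < lam i} = {..<num_parts lam}"
proof -
  have "\<exists>i. lam i = 0"
    using assms infinite_UNIV_nat unfolding is_partition_def
    by (metis (mono_tags, lifting) Collect_cong UNIV_def bot_nat_0.not_eq_extremum)
  then have L: "lam (LEAST i. lam i = 0) = 0" by (rule LeastI_ex)
  have "{i. 0 < lam i} = {..<(LEAST i. lam i = 0)}"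
  proof (intro set_eqI iffI)
    fix i assume i: "i \<in> {i. 0 < lam i}"
    have "i < (LEAST i. lam i = 0)"
    proof (rule ccontr)
      assume "\<not> i < (LEAST i. lam i = 0)"
      then have "lam i \<le> lam (LEAST i. lam i = 0)"
        using assms unfolding is_partition_def antimono_def by simp
      then show False using i L by simp
    qed
    then show "i \<in> {..<(LEAST i. lam i = 0)}" by simp
  qed (auto dest: not_less_Least)
  then show ?thesis by (simp add: num_parts_def)
qed

text \<open>The differences of a gap partition exceed the prescribed gaps by arbitrary non-negative amounts,
  which turns the uniform measure on gap partitions of \<open>n\<close> into the uniform measure on
  unrestricted configurations of weight \<open>n - min_weight qs k\<close>.\<close>

lemma bij_betw_partition_of:
  assumes "gap_sequence qs"
  shows "bij_betw (partition_of qs k) (configs k m) (gap_partitions_of qs (m + min_weight qs k) k)"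
proof (rule bij_betw_byWitness)
  let ?inv = "\<lambda>lam. \<lambda>j\<in>{..<k}. lam j - lam (Suc j) - qs (k - Suc j)"
  show "\<forall>D\<in>configs k m. ?inv (partition_of qs k D) = D"
  proof
    fix D assume "D \<in> configs k m"
    then have "D \<in> extensional {..<k}" by (simp add: configs_def PiE_def)
    then show "?inv (partition_of qs k D) = D"
      by (intro extensionalityI[of _ "{..<k}"]) (auto simp: partition_of_Suc)
  qed
  show inv: "\<forall>lam\<in>gap_partitions_of qs (m + min_weight qs k) k. partition_of qs k (?inv lam) = lam"
  proof
    fix lam assume "lam \<in> gap_partitions_of qs (m + min_weight qs k) k"
    then have lam: "is_partition lam" "num_parts lam = k"
      and gap: "\<And>i. i < k \<Longrightarrow> lam (Suc i) + qs (k - Suc i) \<le> lam i"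
      by (auto simp: gap_partitions_of_def gap_partitions_def)
    have zero: "lam i = 0" if "k \<le> i" for i
    proof -
      have "i \<notin> {i. 0 < lam i}" using partition_support[OF lam(1)] lam(2) that by simp
      then show ?thesis by simp
    qed
    have low: "partition_of qs k (?inv lam) i = lam i" if "i \<le> k" for i
      using that
    proof (induction rule: inc_induct)
      case base
      then show ?case by (simp add: partition_of_def zero)
    next
      case (step i)
      then show ?case using gap[of i] by (simp add: partition_of_Suc)
    qed
    show "partition_of qs k (?inv lam) = lam"
    proof
      fix i show "partition_of qs k (?inv lam) i = lam i"
        using low[of i] zero[of i] by (cases "i \<le> k") (auto simp: partition_of_def)
    qed
  qed
  show "partition_of qs k ` configs k m \<subseteq> gap_partitions_of qs (m + min_weight qs k) k"
    using partition_of_in_gap_partitions[OF assms] weight_partition_of[OF assms]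
    by (auto simp: gap_partitions_of_def configs_def)
  show "?inv ` gap_partitions_of qs (m + min_weight qs k) k \<subseteq> configs k m"
  proof
    fix D assume "D \<in> ?inv ` gap_partitions_of qs (m + min_weight qs k) k"
    then obtain lam where lam: "lam \<in> gap_partitions_of qs (m + min_weight qs k) k" "D = ?inv lam"
      by blast
    then have "weight (partition_of qs k D) = m + min_weight qs k"
      using inv by (simp add: gap_partitions_of_def)
    then have "(\<Sum>j<k. Suc j * D j) = m" by (simp add: weight_partition_of[OF assms])
    moreover have "D \<in> {..<k} \<rightarrow>\<^sub>E UNIV" by (simp add: lam(2))
    ultimately show "D \<in> configs k m" by (simp add: configs_def)
  qed
qed

lemma finite_gap_partitions_of:
  assumes "gap_sequence qs" "min_weight qs k \<le> n"
  shows "finite (gap_partitions_of qs n k)"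
    and "card (gap_partitions_of qs n k) = card (configs k (n - min_weight qs k))"
    and "card {lam \<in> gap_partitions_of qs n k. P lam}
      = card {D \<in> configs k (n - min_weight qs k). P (partition_of qs k D)}"
proof -
  have bij: "bij_betw (partition_of qs k) (configs k (n - min_weight qs k)) (gap_partitions_of qs n k)"
    using bij_betw_partition_of[OF assms(1), of k "n - min_weight qs k"] assms(2) by simp
  show "finite (gap_partitions_of qs n k)" using bij_betw_finite[OF bij] finite_configs by simp
  show "card (gap_partitions_of qs n k) = card (configs k (n - min_weight qs k))"
    using bij_betw_same_card[OF bij] by simp
  have "bij_betw (partition_of qs k) {D \<in> configs k (n - min_weight qs k). P (partition_of qs k D)}
      {lam \<in> gap_partitions_of qs n k. P lam}"
    by (rule bij_betw_subset[OF bij]) (use bij in \<open>auto simp: bij_betw_def\<close>)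
  then show "card {lam \<in> gap_partitions_of qs n k. P lam}
      = card {D \<in> configs k (n - min_weight qs k). P (partition_of qs k D)}"
    using bij_betw_same_card by force
qed

section \<open>From points to the supremum\<close>

text \<open>A monotone function that is close to a continuous monotone \<open>\<phi>\<close> on a fine grid is close to it
  everywhere, and beyond \<open>t1\<close> both are small. So the supremum over \<open>t\<close> costs only finitely
  many pointwise estimates.\<close>

lemma monotone_uniform_grid:
  fixes \<phi> :: "real \<Rightarrow> real"
  assumes "t0 < t1" "0 < \<epsilon>" and cont: "continuous_on {t0..t1} \<phi>"
    and anti: "\<And>s t. t0 \<le> s \<Longrightarrow> s \<le> t \<Longrightarrow> \<phi> t \<le> \<phi> s"
    and nonneg: "\<And>t. t0 \<le> t \<Longrightarrow> 0 \<le> \<phi> t" and small: "\<phi> t1 \<le> \<epsilon>"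
  obtains G where "finite G" "G \<subseteq> {t0..t1}"
    "\<And>Y t. (\<And>s t. t0 \<le> s \<Longrightarrow> s \<le> t \<Longrightarrow> Y t \<le> Y s) \<Longrightarrow> (\<And>t. (0::real) \<le> Y t)
      \<Longrightarrow> (\<And>u. u \<in> G \<Longrightarrow> \<bar>Y u - \<phi> u\<bar> < \<epsilon>) \<Longrightarrow> t0 \<le> t \<Longrightarrow> \<bar>Y t - \<phi> t\<bar> \<le> 2 * \<epsilon>"
proof -
  have "uniformly_continuous_on {t0..t1} \<phi>" using cont by (rule compact_uniformly_continuous) auto
  then obtain d where d: "0 < d"
    "\<And>x y. x \<in> {t0..t1} \<Longrightarrow> y \<in> {t0..t1} \<Longrightarrow> \<bar>y - x\<bar> < d \<Longrightarrow> \<bar>\<phi> y - \<phi> x\<bar> < \<epsilon>"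
    using assms(2) unfolding uniformly_continuous_on_def dist_real_def by metis
  obtain N :: nat where N: "(t1 - t0) / d < real N" using reals_Archimedean2 by blast
  have "0 < (t1 - t0) / d" using assms(1) d(1) by simp
  then have N0: "0 < real N" using N by linarith
  define h where "h = (t1 - t0) / real N"
  have h: "0 < h" "h < d" "real N * h = t1 - t0"
    using N N0 assms(1) d(1) by (auto simp: h_def field_simps)
  define G where "G = (\<lambda>i. t0 + real i * h) ` {..N}"
  have in_range: "t0 + real i * h \<in> {t0..t1}" if "i \<le> N" for i
  proof -
    have "real i * h \<le> real N * h" using that h by (intro mult_right_mono) auto
    then show ?thesis using h by auto
  qed
  show thesis
  proof (rule that[of G])
    show "finite G" by (simp add: G_def)
    show "G \<subseteq> {t0..t1}" using in_range by (auto simp: G_def)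
  next
    fix Y t
    assume Y: "\<And>s t. t0 \<le> s \<Longrightarrow> s \<le> t \<Longrightarrow> Y t \<le> Y s" "\<And>t. (0::real) \<le> Y t"
      "\<And>u. u \<in> G \<Longrightarrow> \<bar>Y u - \<phi> u\<bar> < \<epsilon>" and t: "t0 \<le> t"
    show "\<bar>Y t - \<phi> t\<bar> \<le> 2 * \<epsilon>"
    proof (cases "t1 \<le> t")
      case True
      have "t1 \<in> G" using h unfolding G_def by (intro image_eqI[of _ _ N]) auto
      then have "\<bar>Y t1 - \<phi> t1\<bar> < \<epsilon>" by (rule Y)
      then show ?thesis
        using Y(1)[of t1 t] Y(2)[of t] anti[of t1 t] nonneg[of t] True small t assms(1) by linarith
    next
      case False
      define i where "i = nat \<lfloor>(t - t0) / h\<rfloor>"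
      have q: "0 \<le> (t - t0) / h" using t h by simp
      have i: "real i \<le> (t - t0) / h" "(t - t0) / h < real i + 1" using q unfolding i_def by linarith+
      then have b: "real i * h \<le> t - t0" "t - t0 < (real i + 1) * h" using h by (auto simp: field_simps)
      have "real i * h < real N * h" using b False h by linarith
      then have iN: "i < N" using mult_less_cancel_right_pos[OF h(1)] of_nat_less_iff by blast
      define u v where "u = t0 + real i * h" and "v = t0 + real (Suc i) * h"
      have uv: "u \<in> G" "v \<in> G" "u \<in> {t0..t1}" "v \<in> {t0..t1}"
        using iN in_range[of i] in_range[of "Suc i"]
        by (auto simp: u_def v_def G_def simp del: of_nat_Suc)
      have le: "u \<le> t" "t \<le> v" "v - u = h" using b by (auto simp: u_def v_def algebra_simps)
      have "\<bar>\<phi> u - \<phi> t\<bar> < \<epsilon>" "\<bar>\<phi> v - \<phi> t\<bar> < \<epsilon>"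
        using d(2)[of t u] d(2)[of t v] uv le h t False by auto
      moreover have "Y t \<le> Y u" "Y v \<le> Y t" using Y(1)[of u t] Y(1)[of t v] uv le t by auto
      ultimately show ?thesis using Y(3)[OF uv(1)] Y(3)[OF uv(2)] by linarith
    qed
  qed
qed

lemma deviation_event_antimono:
  assumes "t0' \<le> t0"
  shows "deviation_event qs n k z \<phi> t0 \<epsilon> \<subseteq> deviation_event qs n k z \<phi> t0' \<epsilon>"
proof -
  have "(SUP t\<in>{t0..}. ereal \<bar>z * young_boundary lam (t / z) - \<phi> t\<bar>)
      \<le> (SUP t\<in>{t0'..}. ereal \<bar>z * young_boundary lam (t / z) - \<phi> t\<bar>)" for lam
    using assms by (intro SUP_subset_mono) auto
  then show ?thesis unfolding deviation_event_def by (auto intro: less_le_trans)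
qed

lemma young_boundary_antimono:
  assumes "lam \<in> gap_partitions_of qs n k" "s \<le> t"
  shows "young_boundary lam t \<le> young_boundary lam s"
proof -
  have "antimono lam" using assms by (simp add: gap_partitions_of_def gap_partitions_def is_partition_def)
  moreover have "nat \<lfloor>s\<rfloor> \<le> nat \<lfloor>t\<rfloor>" using assms(2) by (intro nat_mono floor_mono)
  ultimately show ?thesis by (simp add: young_boundary_def antimono_def)
qed

text \<open>The constant factor disappears after division by \<open>sqrt n\<close>. The bound \<open>K\<close> converts a rate in \<open>1 / z\<close>
  into a rate in \<open>sqrt n\<close>.\<close>

lemma exp_rare_imp_limsup_log_prob_less_0:
  assumes "exp_rare z B A" "\<forall>\<^sub>F n in sequentially. 0 < z n"
    and "\<forall>\<^sub>F n in sequentially. finite (B n) \<and> B n \<noteq> {}"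
    and "\<And>n. A n \<subseteq> B n" and K: "\<forall>\<^sub>F n in sequentially. z n * sqrt (real n) \<le> K" "0 < K"
  shows "limsup (\<lambda>n. ereal (1 / sqrt (real n)) *
    log_prob (measure_pmf.prob (pmf_of_set (B n)) (A n))) < 0"
proof -
  obtain C c where c: "0 < c"
    and rare: "\<forall>\<^sub>F n in sequentially. real (card (A n)) \<le> C * exp (- c / z n) * real (card (B n))"
    using assms(1) unfolding exp_rare_def by blast
  define C' c' where "C' = max C 1" and "c' = c / K"
  have C': "0 < C'" "C \<le> C'" and c': "0 < c'" using c K by (auto simp: C'_def c'_def)
  have "filterlim (\<lambda>n. sqrt (real n)) at_top sequentially"
    by (rule filterlim_compose[OF sqrt_at_top filterlim_real_sequentially])
  then have "(\<lambda>n. ln C' / sqrt (real n)) \<longlonglongrightarrow> 0" by (rule real_tendsto_divide_at_top[OF tendsto_const])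
  then have "\<forall>\<^sub>F n in sequentially. ln C' / sqrt (real n) < c' / 2"
    by (rule order_tendstoD) (use c' in simp)
  then have "\<forall>\<^sub>F n in sequentially. ereal (1 / sqrt (real n)) *
      log_prob (measure_pmf.prob (pmf_of_set (B n)) (A n)) \<le> ereal (- (c' / 2))"
    using rare assms(2,3) K(1) eventually_gt_at_top[of 0]
  proof eventually_elim
    case (elim n)
    define p where "p = measure_pmf.prob (pmf_of_set (B n)) (A n)"
    have B: "finite (B n)" "B n \<noteq> {}" "0 < card (B n)" using elim by (auto simp: card_gt_0_iff)
    have n: "0 < sqrt (real n)" using elim by simp
    have "B n \<inter> A n = A n" using assms(4)[of n] by blast
    then have p: "p = real (card (A n)) / real (card (B n))"
      using B by (simp add: p_def measure_pmf_of_set)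
    then have "p \<le> C * exp (- c / z n)" using elim(2) B by (simp only: pos_divide_le_eq of_nat_0_less_iff)
    also have "\<dots> \<le> C' * exp (- c' * sqrt (real n))"
    proof (rule mult_mono)
      have "c * (z n * sqrt (real n)) \<le> c * K" using elim c by (intro mult_left_mono) auto
      then have "c' * sqrt (real n) \<le> c / z n" using K elim by (simp add: c'_def field_simps)
      then show "exp (- c / z n) \<le> exp (- c' * sqrt (real n))" by simp
    qed (use C' in auto)
    finally have le: "p \<le> C' * exp (- c' * sqrt (real n))" .
    show ?case
    proof (cases "p = 0")
      case True
      then show ?thesis using n by (simp add: log_prob_def p_def[symmetric])
    next
      case False
      moreover have "0 \<le> p" by (simp add: p_def)
      ultimately have p0: "0 < p" by linarith
      have "ln p \<le> ln (C' * exp (- c' * sqrt (real n)))" using le p0 by (rule ln_mono)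
      also have "\<dots> = ln C' - c' * sqrt (real n)" using C' by (simp add: ln_mult)
      finally have "ln p / sqrt (real n) \<le> ln C' / sqrt (real n) - c'"
        using n by (simp add: field_simps)
      then have "ln p / sqrt (real n) \<le> - (c' / 2)" using elim(1) by linarith
      then show ?thesis using False by (simp add: log_prob_def p_def[symmetric])
    qed
  qed
  then have "limsup (\<lambda>n. ereal (1 / sqrt (real n)) *
      log_prob (measure_pmf.prob (pmf_of_set (B n)) (A n))) \<le> ereal (- (c' / 2))"
    by (rule Limsup_bounded)
  also have "\<dots> < 0" using c' by simp
  finally show ?thesis .
qed

text \<open>The boundary of a partition is a random tail sum of its configuration plus a deterministic sum of
  gaps. Only the tail sum fluctuates, and the gaps contribute the limit \<open>g\<close>.\<close>

lemma (in tilted_scaling_point) partition_deviation_rare: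
  assumes "gap_sequence qs" "0 < \<epsilon>"
    and m_eq: "\<And>n. m n = n - min_weight qs (k n)"
    and feasible: "\<forall>\<^sub>F n in sequentially. min_weight qs (k n) \<le> n"
    and gaps: "(\<lambda>n. z n * real (\<Sum>l<k n - nat \<lfloor>t / z n\<rfloor>. qs l)) \<longlonglongrightarrow> g"
    and x: "x = g + limit_shape_inf t - shape_lim 1 0"
  shows "exp_rare z (\<lambda>n. gap_partitions_of qs n (k n)) (\<lambda>n. {lam \<in> gap_partitions_of qs n (k n).
    \<epsilon> \<le> \<bar>z n * young_boundary lam (t / z n) - x\<bar>})"
proof -
  have "exp_rare z (\<lambda>n. configs (k n) (m n)) (\<lambda>n. {D \<in> configs (k n) (m n).
      \<epsilon> / 2 \<le> \<bar>z n * tail n D - (limit_shape_inf t - shape_lim 1 0)\<bar>})"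
    using assms(2) by (intro tail_deviation_rare) simp
  then obtain C c where c: "0 < c" and rare: "\<forall>\<^sub>F n in sequentially. real (card {D \<in> configs (k n) (m n).
      \<epsilon> / 2 \<le> \<bar>z n * tail n D - (limit_shape_inf t - shape_lim 1 0)\<bar>})
      \<le> C * exp (- c / z n) * real (card (configs (k n) (m n)))"
    unfolding exp_rare_def by blast
  have "(\<lambda>n. \<bar>z n * real (\<Sum>l<k n - nat \<lfloor>t / z n\<rfloor>. qs l) - g\<bar>) \<longlonglongrightarrow> \<bar>g - g\<bar>"
    by (intro tendsto_intros gaps)
  then have close: "\<forall>\<^sub>F n in sequentially.
      \<bar>z n * real (\<Sum>l<k n - nat \<lfloor>t / z n\<rfloor>. qs l) - g\<bar> < \<epsilon> / 2"
    by (rule order_tendstoD) (use assms(2) in simp)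
  have "\<forall>\<^sub>F n in sequentially. real (card {lam \<in> gap_partitions_of qs n (k n).
      \<epsilon> \<le> \<bar>z n * young_boundary lam (t / z n) - x\<bar>})
      \<le> C * exp (- c / z n) * real (card (gap_partitions_of qs n (k n)))"
    using rare close feasible
  proof eventually_elim
    case (elim n)
    let ?P = "\<lambda>lam. \<epsilon> \<le> \<bar>z n * young_boundary lam (t / z n) - x\<bar>"
    let ?R = "\<lambda>D. \<epsilon> / 2 \<le> \<bar>z n * tail n D - (limit_shape_inf t - shape_lim 1 0)\<bar>"
    have "?R D" if "?P (partition_of qs (k n) D)" for D
    proof -
      have "z n * young_boundary (partition_of qs (k n) D) (t / z n)
          = z n * tail n D + z n * real (\<Sum>l<k n - nat \<lfloor>t / z n\<rfloor>. qs l)"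
        by (simp add: young_boundary_def partition_of_eq tail_def distrib_left del: of_nat_sum)
      then show ?thesis using that elim(2) unfolding x by linarith
    qed
    then have "card {D \<in> configs (k n) (m n). ?P (partition_of qs (k n) D)}
        \<le> card {D \<in> configs (k n) (m n). ?R D}"
      using finite_configs by (intro card_mono) auto
    then show ?case
      using elim(1) finite_gap_partitions_of(2,3)[OF assms(1) elim(3)] by (simp add: m_eq)
  qed
  with c show ?thesis unfolding exp_rare_def by blast
qed

text \<open>The grid is placed in \<open>{t0..t1}\<close>, strictly below the end of the shape, where the pointwise
  estimate applies. The event shrinks as its starting point grows, so a starting point \<open>t0'\<close>
  beyond that end is covered.\<close>

lemma limit_shape_large_deviations:
  fixes qs k :: "nat \<Rightarrow> nat" and m :: "nat \<Rightarrow> nat"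
  assumes scaling: "tilted_scaling k m z dilog_lim" and "gap_sequence qs"
    and m_eq: "\<And>n. m n = n - min_weight qs (k n)"
    and feasible: "\<forall>\<^sub>F n in sequentially. min_weight qs (k n) \<le> n"
    and K: "\<forall>\<^sub>F n in sequentially. z n * sqrt (real n) \<le> K" "0 < K"
    and "t0 < t1" "0 < \<epsilon>" and cont: "continuous_on {t0..t1} \<phi>"
    and anti: "\<And>s t. t0 \<le> s \<Longrightarrow> s \<le> t \<Longrightarrow> \<phi> t \<le> \<phi> s"
    and nonneg: "\<And>t. t0 \<le> t \<Longrightarrow> 0 \<le> \<phi> t" and small: "\<phi> t1 \<le> \<epsilon> / 3"
    and point: "\<And>t. t0 \<le> t \<Longrightarrow> t \<le> t1 \<Longrightarrow> tilted_scaling_point k m z dilog_lim t shape_lim"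
    and gaps: "\<And>t. t0 \<le> t \<Longrightarrow> t \<le> t1 \<Longrightarrow>
      (\<lambda>n. z n * real (\<Sum>l<k n - nat \<lfloor>t / z n\<rfloor>. qs l)) \<longlonglongrightarrow> g t"
    and shape: "\<And>t. t0 \<le> t \<Longrightarrow> t \<le> t1 \<Longrightarrow> \<phi> t = g t + limit_shape_inf t - shape_lim 1 0"
    and t0': "t0 \<le> t0'"
  shows "limsup (\<lambda>n. ereal (1 / sqrt (real n)) *
    log_prob (measure_pmf.prob (gap_uniform qs n (k n))
      (deviation_event qs n (k n) (z n) \<phi> t0' \<epsilon>))) < 0"
proof -
  interpret tilted_scaling k m z dilog_lim by (rule scaling)
  obtain G where G: "finite G" "G \<subseteq> {t0..t1}"
    "\<And>Y t. (\<And>s t. t0 \<le> s \<Longrightarrow> s \<le> t \<Longrightarrow> Y t \<le> Y s) \<Longrightarrow> (\<And>t. (0::real) \<le> Y t)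
      \<Longrightarrow> (\<And>u. u \<in> G \<Longrightarrow> \<bar>Y u - \<phi> u\<bar> < \<epsilon> / 3) \<Longrightarrow> t0 \<le> t \<Longrightarrow> \<bar>Y t - \<phi> t\<bar> \<le> 2 * (\<epsilon> / 3)"
    by (rule monotone_uniform_grid[of t0 t1 "\<epsilon> / 3" \<phi>])
      (use assms(7,8) cont anti nonneg small in auto)
  define A where "A u n = {lam \<in> gap_partitions_of qs n (k n).
      \<epsilon> / 3 \<le> \<bar>z n * young_boundary lam (u / z n) - \<phi> u\<bar>}" for u n
  have A: "exp_rare z (\<lambda>n. gap_partitions_of qs n (k n)) (A u)" if "u \<in> G" for u
  proof -
    have u: "t0 \<le> u" "u \<le> t1" using that G(2) by auto
    interpret tilted_scaling_point k m z dilog_lim u shape_lim by (rule point[OF u])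
    show ?thesis unfolding A_def
      using assms(2,8) m_eq feasible gaps[OF u] shape[OF u] by (intro partition_deviation_rare) auto
  qed
  have "\<forall>\<^sub>F n in sequentially.
      card (deviation_event qs n (k n) (z n) \<phi> t0' \<epsilon>) \<le> card (\<Union>u\<in>G. A u n)"
    using z_pos feasible
  proof eventually_elim
    case (elim n)
    have "deviation_event qs n (k n) (z n) \<phi> t0 \<epsilon> \<subseteq> (\<Union>u\<in>G. A u n)"
    proof
      fix lam assume lam: "lam \<in> deviation_event qs n (k n) (z n) \<phi> t0 \<epsilon>"
      show "lam \<in> (\<Union>u\<in>G. A u n)"
      proof (rule ccontr)
        assume no: "lam \<notin> (\<Union>u\<in>G. A u n)"
        have mem: "lam \<in> gap_partitions_of qs n (k n)" using lam by (simp add: deviation_event_def)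
        have "\<bar>z n * young_boundary lam (t / z n) - \<phi> t\<bar> \<le> 2 * (\<epsilon> / 3)" if "t0 \<le> t" for t
        proof (rule G(3)[of "\<lambda>t. z n * young_boundary lam (t / z n)", OF _ _ _ that])
          show "z n * young_boundary lam (t / z n) \<le> z n * young_boundary lam (s / z n)"
            if "t0 \<le> s" "s \<le> t" for s t
            using that elim
            by (intro mult_left_mono young_boundary_antimono[OF mem] divide_right_mono) auto
          show "0 \<le> z n * young_boundary lam (t / z n)" for t
            using elim by (simp add: young_boundary_def)
          show "\<bar>z n * young_boundary lam (u / z n) - \<phi> u\<bar> < \<epsilon> / 3" if "u \<in> G" for u
            using no mem that by (auto simp: A_def not_le)
        qed
        then have "(SUP t\<in>{t0..}. ereal \<bar>z n * young_boundary lam (t / z n) - \<phi> t\<bar>)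
            \<le> ereal (2 * (\<epsilon> / 3))"
          by (intro SUP_least) auto
        also have "\<dots> < ereal \<epsilon>" using assms(8) by simp
        finally show False using lam by (auto simp: deviation_event_def dest: less_asym)
      qed
    qed
    then have "deviation_event qs n (k n) (z n) \<phi> t0' \<epsilon> \<subseteq> (\<Union>u\<in>G. A u n)"
      by (rule order_trans[OF deviation_event_antimono[OF t0']])
    moreover have "finite (\<Union>u\<in>G. A u n)"
      using G(1) finite_gap_partitions_of(1)[OF assms(2) elim(2)] by (auto simp: A_def)
    ultimately show ?case by (rule card_mono[rotated])
  qed
  then have "exp_rare z (\<lambda>n. gap_partitions_of qs n (k n))
      (\<lambda>n. deviation_event qs n (k n) (z n) \<phi> t0' \<epsilon>)"
    using exp_rare_UN[OF G(1) A z_pos] by (rule exp_rare_mono[rotated])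
  moreover have "\<forall>\<^sub>F n in sequentially.
      finite (gap_partitions_of qs n (k n)) \<and> gap_partitions_of qs n (k n) \<noteq> {}"
    using feasible eventually_card_configs_pos
  proof eventually_elim
    case (elim n)
    then show ?case using finite_gap_partitions_of(1,2)[OF assms(2) elim(1)] by (auto simp: m_eq)
  qed
  ultimately show ?thesis
    unfolding gap_uniform_def using K z_pos
    by (intro exp_rare_imp_limsup_log_prob_less_0) (auto simp: deviation_event_def)
qed

section \<open>Weights and gaps in the two regimes\<close>

text \<open>A single constant for all \<open>i\<close>: the finitely many exceptional values are absorbed by a sum of their
  ratios. At \<open>i = 0\<close> both sides vanish, since \<open>0 powr \<beta> = 0\<close>.\<close>

lemma gap_sum_bound:
  assumes "(\<lambda>m. real (\<Sum>i<m. qs i) - q * real m) \<in> O(\<lambda>m. real m powr \<beta>)"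
  obtains C where "0 \<le> C" "\<And>i. \<bar>real (\<Sum>l<i. qs l) - q * real i\<bar> \<le> C * real i powr \<beta>"
proof -
  obtain C0 where "0 < C0" and C0: "\<forall>\<^sub>F i in sequentially.
      norm (real (\<Sum>l<i. qs l) - q * real i) \<le> C0 * norm (real i powr \<beta>)"
    using landau_o.bigE[OF assms] by blast
  from C0 obtain N where N: "\<And>i. N \<le> i \<Longrightarrow>
      \<bar>real (\<Sum>l<i. qs l) - q * real i\<bar> \<le> C0 * real i powr \<beta>"
    unfolding eventually_sequentially by auto
  define e where "e i = \<bar>real (\<Sum>l<i. qs l) - q * real i\<bar>" for i
  define C where "C = C0 + (\<Sum>i<N. e i / real i powr \<beta>)"
  have pos: "0 \<le> e i / real i powr \<beta>" for i by (simp add: e_def)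
  have "e i \<le> C * real i powr \<beta>" for i
  proof (cases "i = 0")
    case False
    then have p: "0 < real i powr \<beta>" by simp
    have "e i / real i powr \<beta> \<le> C"
    proof (cases "i < N")
      case True
      then have "e i / real i powr \<beta> \<le> (\<Sum>i<N. e i / real i powr \<beta>)"
        by (intro member_le_sum pos) auto
      then show ?thesis using \<open>0 < C0\<close> by (simp add: C_def)
    next
      case False
      then have "e i / real i powr \<beta> \<le> C0" using N[of i] p by (simp add: e_def divide_le_eq)
      then show ?thesis using sum_nonneg[of "{..<N}" "\<lambda>i. e i / real i powr \<beta>"] pos
        by (simp add: C_def)
    qed
    then show ?thesis using p by (simp add: divide_le_eq)
  qed (simp add: e_def)
  moreover have "0 \<le> C"
    using \<open>0 < C0\<close> sum_nonneg[of "{..<N}" "\<lambda>i. e i / real i powr \<beta>"] pos by (simp add: C_def)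
  ultimately show thesis using that unfolding e_def by blast
qed

lemma min_weight_bound:
  assumes "0 \<le> \<beta>" "0 \<le> C" "\<And>i. \<bar>real (\<Sum>l<i. qs l) - q * real i\<bar> \<le> C * real i powr \<beta>"
  shows "\<bar>real (min_weight qs k) - q * (real k * (real k + 1) / 2)\<bar> \<le> C * real k powr (\<beta> + 1)"
proof -
  have "(\<Sum>i<k. q * real (Suc i)) = q * (real k * (real k + 1) / 2)"
    by (induction k) (auto simp: field_simps)
  then have "real (min_weight qs k) - q * (real k * (real k + 1) / 2)
      = (\<Sum>i<k. real (\<Sum>l<Suc i. qs l) - q * real (Suc i))"
    by (simp only: min_weight_eq of_nat_sum sum_subtractf)
  then have "\<bar>real (min_weight qs k) - q * (real k * (real k + 1) / 2)\<bar>
      \<le> (\<Sum>i<k. \<bar>real (\<Sum>l<Suc i. qs l) - q * real (Suc i)\<bar>)"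
    by (simp only: sum_abs)
  also have "\<dots> \<le> (\<Sum>i<k. C * real k powr \<beta>)"
  proof (rule sum_mono)
    fix i assume "i \<in> {..<k}"
    then have "C * real (Suc i) powr \<beta> \<le> C * real k powr \<beta>"
      using assms by (intro mult_left_mono powr_mono2) auto
    then show "\<bar>real (\<Sum>l<Suc i. qs l) - q * real (Suc i)\<bar> \<le> C * real k powr \<beta>"
      using assms(3)[of "Suc i"] by linarith
  qed
  also have "\<dots> = C * real k powr (\<beta> + 1)"
    by (cases "k = 0") (auto simp: powr_add)
  finally show ?thesis .
qed

lemma gap_sum_scaled_tendsto:
  assumes "0 \<le> \<beta>" "0 \<le> C" and C: "\<And>i. \<bar>real (\<Sum>l<i. qs l) - q * real i\<bar> \<le> C * real i powr \<beta>"
    and z: "\<forall>\<^sub>F n in sequentially. 0 < z n"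
    and err: "(\<lambda>n. z n * real (k n) powr \<beta>) \<longlonglongrightarrow> 0"
    and main: "(\<lambda>n. q * (z n * real (k n - j n))) \<longlonglongrightarrow> g"
  shows "(\<lambda>n. z n * real (\<Sum>l<k n - j n. qs l)) \<longlonglongrightarrow> g"
proof -
  have "(\<lambda>n. z n * real (\<Sum>l<k n - j n. qs l) - q * (z n * real (k n - j n))) \<longlonglongrightarrow> 0"
  proof (rule Lim_null_comparison)
    show "(\<lambda>n. C * (z n * real (k n) powr \<beta>)) \<longlonglongrightarrow> 0"
      using tendsto_mult_left[OF err, of C] by simp
    show "\<forall>\<^sub>F n in sequentially. norm (z n * real (\<Sum>l<k n - j n. qs l) - q * (z n * real (k n - j n)))
        \<le> C * (z n * real (k n) powr \<beta>)"
      using z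
    proof eventually_elim
      case (elim n)
      have "\<bar>real (\<Sum>l<k n - j n. qs l) - q * real (k n - j n)\<bar> \<le> C * real (k n - j n) powr \<beta>"
        by (rule C)
      also have "\<dots> \<le> C * real (k n) powr \<beta>"
        using assms(1,2) by (intro mult_left_mono powr_mono2) auto
      finally have "z n * \<bar>real (\<Sum>l<k n - j n. qs l) - q * real (k n - j n)\<bar>
          \<le> z n * (C * real (k n) powr \<beta>)"
        using elim by (intro mult_left_mono) auto
      moreover have "z n * real (\<Sum>l<k n - j n. qs l) - q * (z n * real (k n - j n))
          = z n * (real (\<Sum>l<k n - j n. qs l) - q * real (k n - j n))"
        by (simp add: right_diff_distrib mult_ac del: of_nat_sum)
      ultimately show ?case using elim by (simp add: abs_mult mult_ac del: of_nat_sum)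
    qed
  qed
  from tendsto_add[OF this main] show ?thesis by simp
qed

lemma limit_shape_eq:
  assumes "0 < t" "t \<le> T"
  shows "limit_shape q T t = q * (T - t) + limit_shape_inf t - limit_shape_inf T"
  using assms by (simp add: limit_shape_def limit_shape_inf_def ln_div)

lemma limit_shape_nonneg: "0 \<le> q \<Longrightarrow> 0 < t \<Longrightarrow> 0 \<le> limit_shape q T t"
proof (cases "t \<le> T")
  case True
  assume "0 \<le> q" "0 < t"
  moreover from this have "0 \<le> q * (T - t)" using True by simp
  moreover have "limit_shape_inf T \<le> limit_shape_inf t"
    by (rule shape_antimono[OF \<open>0 < t\<close> True])
  ultimately show ?thesis unfolding limit_shape_eq[OF \<open>0 < t\<close> True] by linarith
qed (simp add: limit_shape_def)

lemma limit_shape_antimono: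
  assumes "0 \<le> q" "0 < s" "s \<le> t"
  shows "limit_shape q T t \<le> limit_shape q T s"
proof (cases "t \<le> T")
  case True
  have "q * (T - t) \<le> q * (T - s)" using assms by (intro mult_left_mono) auto
  then show ?thesis
    using limit_shape_eq[of t T q] limit_shape_eq[of s T q] shape_antimono[of s t] assms True
    by simp
next
  case False
  then show ?thesis using limit_shape_nonneg[OF assms(1,2)] by (simp add: limit_shape_def)
qed

text \<open>Here \<open>z n * k n\<close> is equal to \<open>T\<close>. The minimal weight uses up \<open>q * k\<^sup>2 / 2\<close> of \<open>n\<close>, and the equation for
  \<open>T\<close> says exactly that the remaining weight times \<open>z\<^sup>2\<close> tends to \<open>dilog_exp T\<close>.\<close>

lemma sqrt_length_deviations:
  fixes qs k :: "nat \<Rightarrow> nat" and q \<beta> \<tau> T :: real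
  assumes gap: "gap_sequence qs" and q: "0 \<le> q" and \<beta>: "0 \<le> \<beta>" "\<beta> < 1"
    and O: "(\<lambda>m. real (\<Sum>i<m. qs i) - q * real m) \<in> O(\<lambda>m. real m powr \<beta>)"
    and k_pos: "\<And>n. 0 < k n" and k_top: "filterlim k at_top sequentially"
    and \<tau>: "0 < \<tau>" "(\<lambda>n. real (k n) / sqrt (real n)) \<longlonglongrightarrow> \<tau>"
    and T: "0 < T" "\<tau> * vartheta q T = T" and t0: "0 < t0" and \<epsilon>: "0 < \<epsilon>"
  shows "limsup (\<lambda>n. ereal (1 / sqrt (real n)) *
    log_prob (measure_pmf.prob (gap_uniform qs n (k n))
      (deviation_event qs n (k n) (T / real (k n)) (limit_shape q T) t0 \<epsilon>))) < 0"
proof -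
  obtain C where C: "0 \<le> C" "\<And>i. \<bar>real (\<Sum>l<i. qs l) - q * real i\<bar> \<le> C * real i powr \<beta>"
    using gap_sum_bound[OF O] by blast
  define z where "z n = T / real (k n)" for n
  define m where "m n = n - min_weight qs (k n)" for n
  have zk: "z n * real (k n) = T" for n using k_pos[of n] by (simp add: z_def)
  have z_pos: "0 < z n" for n using k_pos[of n] T by (simp add: z_def)
  have k_real: "filterlim (\<lambda>n. real (k n)) at_top sequentially"
    by (rule filterlim_compose[OF filterlim_real_sequentially k_top])
  have z0: "z \<longlonglongrightarrow> 0" unfolding z_def by (rule real_tendsto_divide_at_top[OF tendsto_const k_real])
  have powr0: "(\<lambda>n. real (k n) powr (\<beta> - 1)) \<longlonglongrightarrow> 0"
    using tendsto_neg_powr[OF _ k_real] \<beta> by simp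
  have inv_k: "(\<lambda>n. 1 / real (k n)) \<longlonglongrightarrow> 0" by (rule real_tendsto_divide_at_top[OF tendsto_const k_real])
  have min_lim: "(\<lambda>n. real (min_weight qs (k n)) / (real (k n))\<^sup>2) \<longlonglongrightarrow> q / 2"
  proof -
    have "(\<lambda>n. real (min_weight qs (k n)) / (real (k n))\<^sup>2 - q * (1 + 1 / real (k n)) / 2) \<longlonglongrightarrow> 0"
    proof (rule Lim_null_comparison)
      show "(\<lambda>n. C * real (k n) powr (\<beta> - 1)) \<longlonglongrightarrow> 0" using tendsto_mult_left[OF powr0, of C] by simp
      show "\<forall>\<^sub>F n in sequentially. norm (real (min_weight qs (k n)) / (real (k n))\<^sup>2
          - q * (1 + 1 / real (k n)) / 2) \<le> C * real (k n) powr (\<beta> - 1)"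
      proof (rule always_eventually, rule allI)
        fix n
        define x where "x = real (k n)"
        have x: "0 < x" using k_pos by (simp add: x_def)
        have "real (min_weight qs (k n)) / x\<^sup>2 - q * (1 + 1 / x) / 2
            = (real (min_weight qs (k n)) - q * (x * (x + 1) / 2)) / x\<^sup>2"
          using x by (simp add: field_simps power2_eq_square)
        then have "norm (real (min_weight qs (k n)) / x\<^sup>2 - q * (1 + 1 / x) / 2)
            = \<bar>real (min_weight qs (k n)) - q * (x * (x + 1) / 2)\<bar> / x\<^sup>2" by simp
        also have "\<dots> \<le> C * x powr (\<beta> + 1) / x\<^sup>2"
          unfolding x_def by (intro divide_right_mono min_weight_bound \<beta> C) auto
        also have "\<dots> = C * x powr (\<beta> - 1)"
        proof -
          have "x powr (\<beta> + 1) = x powr (\<beta> - 1) * x\<^sup>2"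
            using x by (simp add: add.commute flip: powr_add powr_numeral)
          then show ?thesis using x by simp
        qed
        finally show "norm (real (min_weight qs (k n)) / (real (k n))\<^sup>2 - q * (1 + 1 / real (k n)) / 2)
            \<le> C * real (k n) powr (\<beta> - 1)" by (simp add: x_def)
      qed
    qed
    moreover have "(\<lambda>n. q * (1 + 1 / real (k n)) / 2) \<longlonglongrightarrow> q * (1 + 0) / 2"
      by (intro tendsto_intros inv_k) auto
    ultimately show ?thesis using tendsto_add by fastforce
  qed
  have n_lim: "(\<lambda>n. real n / (real (k n))\<^sup>2) \<longlonglongrightarrow> 1 / \<tau>\<^sup>2"
  proof -
    have "(\<lambda>n. 1 / (real (k n) / sqrt (real n))\<^sup>2) \<longlonglongrightarrow> 1 / \<tau>\<^sup>2"
      using \<tau> by (intro tendsto_intros) auto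
    moreover have "1 / (real (k n) / sqrt (real n))\<^sup>2 = real n / (real (k n))\<^sup>2" for n
      by (simp add: power_divide)
    ultimately show ?thesis by simp
  qed
  have fixp: "dilog_exp T / T\<^sup>2 = 1 / \<tau>\<^sup>2 - q / 2"
    using vartheta_fixed_point_iff[OF \<tau>(1) T(1) q] T(2) by simp
  have diff_lim: "(\<lambda>n. real n / (real (k n))\<^sup>2 - real (min_weight qs (k n)) / (real (k n))\<^sup>2)
      \<longlonglongrightarrow> dilog_exp T / T\<^sup>2"
    unfolding fixp by (intro tendsto_intros n_lim min_lim)
  then have "\<forall>\<^sub>F n in sequentially.
      0 < real n / (real (k n))\<^sup>2 - real (min_weight qs (k n)) / (real (k n))\<^sup>2"
    by (rule order_tendstoD) (use dilog_exp_pos T in simp)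
  then have feasible: "\<forall>\<^sub>F n in sequentially. min_weight qs (k n) \<le> n"
  proof eventually_elim
    case (elim n)
    then show ?case using k_pos[of n] by (simp add: divide_less_cancel split: if_splits)
  qed
  have m_lim: "(\<lambda>n. (z n)\<^sup>2 * real (m n)) \<longlonglongrightarrow> dilog_exp (1 * T)"
  proof -
    have "(\<lambda>n. T\<^sup>2 * (real n / (real (k n))\<^sup>2 - real (min_weight qs (k n)) / (real (k n))\<^sup>2))
        \<longlonglongrightarrow> T\<^sup>2 * (dilog_exp T / T\<^sup>2)"
      by (intro tendsto_intros diff_lim)
    moreover have "\<forall>\<^sub>F n in sequentially.
        T\<^sup>2 * (real n / (real (k n))\<^sup>2 - real (min_weight qs (k n)) / (real (k n))\<^sup>2)
        = (z n)\<^sup>2 * real (m n)"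
      using feasible
      by eventually_elim (simp add: m_def z_def power_divide of_nat_diff diff_divide_distrib right_diff_distrib)
    ultimately show ?thesis using T(1) by (simp add: tendsto_cong)
  qed
  have scaling: "tilted_scaling k m z (\<lambda>a. dilog_exp (a * T))"
  proof
    show "dilog_exp (a * T) / a\<^sup>2 < dilog_exp (1 * T)" if "1 < a" for a
      using dilog_exp_div_square_strict_antimono[of T "a * T"] T(1) that
      by (simp add: power_mult_distrib field_simps)
    have "isCont (\<lambda>a. a * T) 1" by (intro continuous_intros)
    then show "isCont (\<lambda>a. dilog_exp (a * T)) 1"
      by (rule isCont_o2) (use isCont_dilog_exp T in simp)
    show "0 < dilog_exp (a * T)" if "0 < a" for a using dilog_exp_pos T that by simp
    show "(\<lambda>n. dilog_exp (a * (z n * real (k n)))) \<longlonglongrightarrow> dilog_exp (a * T)" for a by (simp add: zk)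
  qed (use k_pos z_pos z0 m_lim in auto)
  \<comment> \<open>As \<open>t0\<close> may lie beyond \<open>T\<close>, the estimate starts at a point \<open>u < T\<close>.\<close>
  define u where "u = min t0 (T / 2)"
  have u: "0 < u" "u < T" "u \<le> t0" using T t0 by (auto simp: u_def)
  have shape_cont: "continuous_on {u..T} (limit_shape q T)"
  proof (subst continuous_on_cong[OF refl])
    show "limit_shape q T t = q * (T - t) + limit_shape_inf t - limit_shape_inf T" if "t \<in> {u..T}" for t
      using that u by (intro limit_shape_eq) auto
    have "continuous_on {u..T} limit_shape_inf"
      using u by (intro continuous_at_imp_continuous_on ballI isCont_shape) auto
    then show "continuous_on {u..T} (\<lambda>t. q * (T - t) + limit_shape_inf t - limit_shape_inf T)"
      by (intro continuous_intros)
  qed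
  obtain v where v: "u < v" "v < T" "limit_shape q T v \<le> \<epsilon> / 3"
  proof -
    have "(limit_shape q T \<longlongrightarrow> limit_shape q T T) (at T within {u..T})"
      using shape_cont u by (simp add: continuous_on_def)
    moreover have "at T within {u..T} = at_left T" using u by (simp add: at_within_Icc_at_left)
    moreover have "limit_shape q T T = 0" using T by (simp add: limit_shape_eq)
    ultimately have "(limit_shape q T \<longlongrightarrow> 0) (at_left T)" by simp
    then have "\<forall>\<^sub>F v in at_left T. limit_shape q T v < \<epsilon> / 3"
      by (rule order_tendstoD) (use \<epsilon> in simp)
    moreover have "\<forall>\<^sub>F v in at_left T. v \<in> {u<..<T}" using u by (intro eventually_at_left_real) auto
    ultimately have "\<forall>\<^sub>F v in at_left T. u < v \<and> v < T \<and> limit_shape q T v \<le> \<epsilon> / 3"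
      by eventually_elim auto
    then obtain v where "u < v \<and> v < T \<and> limit_shape q T v \<le> \<epsilon> / 3"
      using eventually_happens'[OF trivial_limit_at_left_real] by blast
    then show thesis using that by blast
  qed
  have point: "tilted_scaling_point k m z (\<lambda>a. dilog_exp (a * T)) t
      (\<lambda>a s. limit_shape_inf (a * T - s))" if t: "u \<le> t" "t \<le> v" for t
  proof -
    interpret tilted_scaling k m z "\<lambda>a. dilog_exp (a * T)" by (rule scaling)
    have cont: "isCont limit_shape_inf (T - s)" if "\<bar>s\<bar> < t" for s
      using that t v by (intro isCont_shape) auto
    show ?thesis
    proof
      show "(\<lambda>n. limit_shape_inf (a * (z n * real (k n)) - s)) \<longlonglongrightarrow> limit_shape_inf (a * T - s)" for a s
        by (simp add: zk)
      show "((\<lambda>a. limit_shape_inf (a * T - s)) \<longlongrightarrow> limit_shape_inf (1 * T - s)) (at_right 1)"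
        if "\<bar>s\<bar> < t" for s
      proof (rule isCont_tendsto_compose[where g = limit_shape_inf])
        show "((\<lambda>a. a * T - s) \<longlongrightarrow> 1 * T - s) (at_right 1)" by (intro tendsto_intros)
      qed (use cont that in simp)
      show "((\<lambda>s. limit_shape_inf (1 * T - s)) \<longlongrightarrow> limit_shape_inf (1 * T - 0)) (at 0)"
      proof (rule isCont_tendsto_compose[where g = limit_shape_inf])
        show "((\<lambda>s. 1 * T - s) \<longlongrightarrow> 1 * T - 0) (at 0)" by (intro tendsto_intros)
      qed (use cont[of 0] t u in simp)
    qed (use t u v zk in auto)
  qed
  have gaps: "(\<lambda>n. z n * real (\<Sum>l<k n - nat \<lfloor>t / z n\<rfloor>. qs l)) \<longlonglongrightarrow> q * (T - t)"
    if t: "u \<le> t" "t \<le> v" for t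
  proof (rule gap_sum_scaled_tendsto[OF \<beta>(1) C])
    have "z n * real (k n) powr \<beta> = T * real (k n) powr (\<beta> - 1)" for n
      using k_pos[of n] by (simp add: z_def powr_diff)
    then show "(\<lambda>n. z n * real (k n) powr \<beta>) \<longlonglongrightarrow> 0" using tendsto_mult_left[OF powr0, of T] by simp
    have "(\<lambda>n. T - z n * real (nat \<lfloor>t / z n\<rfloor>)) \<longlonglongrightarrow> T - t"
      using t u z_pos by (intro tendsto_intros floor_step_tendsto z0) auto
    moreover have "z n * real (k n - nat \<lfloor>t / z n\<rfloor>) = T - z n * real (nat \<lfloor>t / z n\<rfloor>)" for n
    proof -
      have "t / z n \<le> real (k n)" using z_pos[of n] zk[of n] t v by (simp add: field_simps)
      then have "nat \<lfloor>t / z n\<rfloor> \<le> k n" by linarith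
      then show ?thesis using zk[of n] by (simp add: of_nat_diff right_diff_distrib)
    qed
    ultimately show "(\<lambda>n. q * (z n * real (k n - nat \<lfloor>t / z n\<rfloor>))) \<longlonglongrightarrow> q * (T - t)"
      by (intro tendsto_mult_left) simp
  qed (use z_pos in auto)
  have "(\<lambda>n. T * (1 / (real (k n) / sqrt (real n)))) \<longlonglongrightarrow> T * (1 / \<tau>)"
    using \<tau> by (intro tendsto_intros) auto
  then have "\<forall>\<^sub>F n in sequentially. T * (1 / (real (k n) / sqrt (real n))) < T * (1 / \<tau>) + 1"
    by (rule order_tendstoD) simp
  then have bounded: "\<forall>\<^sub>F n in sequentially. z n * sqrt (real n) \<le> T * (1 / \<tau>) + 1"
    by eventually_elim (simp add: z_def)
  have "limsup (\<lambda>n. ereal (1 / sqrt (real n)) *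
    log_prob (measure_pmf.prob (gap_uniform qs n (k n))
      (deviation_event qs n (k n) (z n) (limit_shape q T) t0 \<epsilon>))) < 0"
  proof (rule limit_shape_large_deviations[OF scaling gap _ feasible bounded, where ?t0.0 = u and ?t1.0 = v
        and g = "\<lambda>t. q * (T - t)" and shape_lim = "\<lambda>a s. limit_shape_inf (a * T - s)"])
    show "continuous_on {u..v} (limit_shape q T)"
      by (rule continuous_on_subset[OF shape_cont]) (use v in auto)
    show "limit_shape q T t = q * (T - t) + limit_shape_inf t - limit_shape_inf (1 * T - 0)"
      if "u \<le> t" "t \<le> v" for t using that u v by (simp add: limit_shape_eq)
    show "0 < T * (1 / \<tau>) + 1" using T \<tau> by (simp add: add_pos_pos)
  qed (use u v \<epsilon> point gaps limit_shape_antimono[OF q] limit_shape_nonneg[OF q] m_def in auto)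
  then show ?thesis by (simp add: z_def)
qed

text \<open>Here \<open>z n * k n\<close> tends to infinity, so the bound on the length is asymptotically inactive. The
  growth condition on \<open>k\<close> makes both the minimal weight and the rescaled gaps negligible.\<close>

lemma large_length_deviations:
  fixes qs k :: "nat \<Rightarrow> nat" and \<beta> \<delta> :: real
  assumes gap: "gap_sequence qs" and \<beta>: "0 \<le> \<beta>"
    and O: "(\<lambda>m. real (\<Sum>i<m. qs i) - 0 * real m) \<in> O(\<lambda>m. real m powr \<beta>)"
    and k_pos: "\<And>n. 0 < k n"
    and k_large: "filterlim (\<lambda>n. real (k n) / sqrt (real n)) at_top sequentially"
    and \<delta>: "0 < \<delta>"
      "limsup (\<lambda>n. ereal (real (k n) powr (\<beta> + 1) / real n powr (1 - \<delta>))) < \<infinity>"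
    and t0: "0 < t0" and \<epsilon>: "0 < \<epsilon>"
  shows "limsup (\<lambda>n. ereal (1 / sqrt (real n)) *
    log_prob (measure_pmf.prob (gap_uniform qs n (k n))
      (deviation_event qs n (k n) (pi / sqrt (6 * real n)) limit_shape_inf t0 \<epsilon>))) < 0"
proof -
  obtain C where C: "0 \<le> C" "\<And>i. \<bar>real (\<Sum>l<i. qs l) - 0 * real i\<bar> \<le> C * real i powr \<beta>"
    using gap_sum_bound[OF O] by blast
  define z where "z n = pi / sqrt (6 * real n)" for n
  define m where "m n = n - min_weight qs (k n)" for n
  have z_pos: "\<forall>\<^sub>F n in sequentially. 0 < z n"
    using eventually_gt_at_top[of 0] by eventually_elim (simp add: z_def)
  have sq: "filterlim (\<lambda>n. sqrt (real n)) at_top sequentially"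
    by (rule filterlim_compose[OF sqrt_at_top filterlim_real_sequentially])
  have z_eq: "z n = pi / sqrt 6 / sqrt (real n)" for n by (simp add: z_def real_sqrt_mult)
  have z0: "z \<longlonglongrightarrow> 0" unfolding z_eq by (rule real_tendsto_divide_at_top[OF tendsto_const sq])
  have zk: "filterlim (\<lambda>n. z n * real (k n)) at_top sequentially"
  proof -
    have "filterlim (\<lambda>n. pi / sqrt 6 * (real (k n) / sqrt (real n))) at_top sequentially"
      by (rule filterlim_tendsto_pos_mult_at_top[OF tendsto_const _ k_large]) simp
    then show ?thesis by (simp add: z_eq)
  qed
  obtain K where K: "\<forall>\<^sub>F n in sequentially. real (k n) powr (\<beta> + 1) / real n powr (1 - \<delta>) < K"
  proof -
    obtain K where "limsup (\<lambda>n. ereal (real (k n) powr (\<beta> + 1) / real n powr (1 - \<delta>))) < ereal K"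
      using \<delta>(2) less_PInf_Ex_of_nat by auto
    then show thesis using that Limsup_lessD by fastforce
  qed
  have n_powr: "(\<lambda>n. real n powr (- \<delta>)) \<longlonglongrightarrow> 0"
    using tendsto_neg_powr[OF _ filterlim_real_sequentially, of "- \<delta>"] \<delta> by simp
  have k_ratio: "\<forall>\<^sub>F n in sequentially. real (k n) powr (\<beta> + 1) \<le> K * (real n * real n powr (- \<delta>))"
    using K eventually_gt_at_top[of 0]
  proof eventually_elim
    case (elim n)
    then have "real (k n) powr (\<beta> + 1) \<le> K * real n powr (1 - \<delta>)" by (simp add: field_simps)
    also have "real n powr (1 - \<delta>) = real n * real n powr (- \<delta>)"
      using elim by (simp add: powr_diff powr_minus divide_inverse)
    finally show ?case .
  qed
  have min_lim: "(\<lambda>n. real (min_weight qs (k n)) / real n) \<longlonglongrightarrow> 0"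
  proof (rule Lim_null_comparison)
    show "(\<lambda>n. C * K * real n powr (- \<delta>)) \<longlonglongrightarrow> 0" using tendsto_mult_left[OF n_powr, of "C * K"] by simp
    show "\<forall>\<^sub>F n in sequentially. norm (real (min_weight qs (k n)) / real n) \<le> C * K * real n powr (- \<delta>)"
      using k_ratio eventually_gt_at_top[of 0]
    proof eventually_elim
      case (elim n)
      have "real (min_weight qs (k n)) \<le> C * real (k n) powr (\<beta> + 1)"
        using min_weight_bound[OF \<beta> C, of "k n"] by simp
      also have "\<dots> \<le> C * (K * (real n * real n powr (- \<delta>)))" using elim C by (intro mult_left_mono) auto
      finally show ?case using elim by (simp add: divide_le_eq mult_ac)
    qed
  qed
  have "\<forall>\<^sub>F n in sequentially. real (min_weight qs (k n)) / real n < 1"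
    using min_lim by (rule order_tendstoD) simp
  then have feasible: "\<forall>\<^sub>F n in sequentially. min_weight qs (k n) \<le> n"
    using eventually_gt_at_top[of 0] by eventually_elim (simp add: divide_less_eq)
  have m_lim: "(\<lambda>n. (z n)\<^sup>2 * real (m n)) \<longlonglongrightarrow> pi\<^sup>2 / 6"
  proof -
    have "(\<lambda>n. pi\<^sup>2 / 6 * (1 - real (min_weight qs (k n)) / real n)) \<longlonglongrightarrow> pi\<^sup>2 / 6 * (1 - 0)"
      by (intro tendsto_intros min_lim)
    moreover have "\<forall>\<^sub>F n in sequentially.
        pi\<^sup>2 / 6 * (1 - real (min_weight qs (k n)) / real n) = (z n)\<^sup>2 * real (m n)"
      using feasible eventually_gt_at_top[of 0]
      by eventually_elim (simp add: m_def z_def power_divide of_nat_diff field_simps)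
    ultimately show ?thesis by (simp add: tendsto_cong)
  qed
  have scaling: "tilted_scaling k m z (\<lambda>a. pi\<^sup>2 / 6)"
  proof
    show "(\<lambda>n. dilog_exp (a * (z n * real (k n)))) \<longlonglongrightarrow> pi\<^sup>2 / 6" if "0 < a" for a
      by (intro filterlim_compose[OF dilog_exp_tendsto]
          filterlim_tendsto_pos_mult_at_top[OF tendsto_const that zk])
    show "pi\<^sup>2 / 6 / a\<^sup>2 < pi\<^sup>2 / 6" if "1 < a" for a :: real
    proof -
      have "1 < a\<^sup>2" using that by (simp add: one_less_power)
      then show ?thesis by (simp add: divide_less_eq)
    qed
  qed (use k_pos z_pos z0 m_lim in auto)
  have "\<forall>\<^sub>F v in at_top. limit_shape_inf v < \<epsilon> / 3"
    by (rule order_tendstoD(2)[OF shape_tendsto_0]) (use \<epsilon> in simp)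
  then have "\<forall>\<^sub>F v in at_top. limit_shape_inf v < \<epsilon> / 3 \<and> t0 < v"
    using eventually_gt_at_top[of t0] by eventually_elim simp
  then obtain v where v: "t0 < v" "limit_shape_inf v < \<epsilon> / 3"
    using eventually_happens[of _ "at_top :: real filter"] by fastforce
  have point: "tilted_scaling_point k m z (\<lambda>a. pi\<^sup>2 / 6) t (\<lambda>a s. 0)" if t: "t0 \<le> t" "t \<le> v" for t
  proof -
    interpret tilted_scaling k m z "\<lambda>a. pi\<^sup>2 / 6" by (rule scaling)
    show ?thesis
    proof
      show "(\<lambda>n. limit_shape_inf (a * (z n * real (k n)) - s)) \<longlonglongrightarrow> 0" if "1 < a" for a s
      proof (rule filterlim_compose[OF shape_tendsto_0])
        have "filterlim (\<lambda>n. - s + a * (z n * real (k n))) at_top sequentially"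
          by (intro filterlim_tendsto_add_at_top[OF tendsto_const]
              filterlim_tendsto_pos_mult_at_top[OF tendsto_const _ zk]) (use that in simp)
        then show "filterlim (\<lambda>n. a * (z n * real (k n)) - s) at_top sequentially" by simp
      qed
      show "\<forall>\<^sub>F n in sequentially. t \<le> z n * real (k n)" using zk by (simp add: filterlim_at_top)
    qed (use t t0 in auto)
  qed
  have gaps: "(\<lambda>n. z n * real (\<Sum>l<k n - nat \<lfloor>t / z n\<rfloor>. qs l)) \<longlonglongrightarrow> 0" for t
  proof (rule gap_sum_scaled_tendsto[OF \<beta> C z_pos])
    \<comment> \<open>As \<open>k n\<close> exceeds \<open>sqrt n\<close>, the power \<open>k n powr \<beta>\<close> is at most
       \<open>k n powr (\<beta> + 1) / sqrt n\<close>.\<close>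
    show "(\<lambda>n. z n * real (k n) powr \<beta>) \<longlonglongrightarrow> 0"
    proof (rule Lim_null_comparison)
      show "(\<lambda>n. pi / sqrt 6 * K * real n powr (- \<delta>)) \<longlonglongrightarrow> 0"
        using tendsto_mult_left[OF n_powr, of "pi / sqrt 6 * K"] by simp
      have "\<forall>\<^sub>F n in sequentially. 1 \<le> real (k n) / sqrt (real n)"
        using k_large by (simp add: filterlim_at_top)
      then show "\<forall>\<^sub>F n in sequentially. norm (z n * real (k n) powr \<beta>)
          \<le> pi / sqrt 6 * K * real n powr (- \<delta>)"
        using k_ratio z_pos eventually_gt_at_top[of 0]
      proof eventually_elim
        case (elim n)
        have s: "0 < sqrt (real n)" using elim by simp
        have "real (k n) powr \<beta> * sqrt (real n) \<le> real (k n) powr \<beta> * real (k n)"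
          using elim s by (intro mult_left_mono) (auto simp: le_divide_eq)
        also have "\<dots> = real (k n) powr (\<beta> + 1)" using k_pos[of n] by (simp add: powr_add)
        also have "\<dots> \<le> K * (sqrt (real n) * sqrt (real n) * real n powr (- \<delta>))" using elim by simp
        finally have "real (k n) powr \<beta> * sqrt (real n)
            \<le> K * (sqrt (real n) * real n powr (- \<delta>)) * sqrt (real n)"
          by (simp only: mult_ac)
        then have "real (k n) powr \<beta> \<le> K * (sqrt (real n) * real n powr (- \<delta>))"
          by (rule mult_right_le_imp_le[OF _ s])
        then have "z n * real (k n) powr \<beta> \<le> z n * (K * (sqrt (real n) * real n powr (- \<delta>)))"
          using elim by (intro mult_left_mono) auto
        also have "\<dots> = pi / sqrt 6 * K * real n powr (- \<delta>)" using s by (simp add: z_eq)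
        finally show ?case using elim by simp
      qed
    qed
  qed simp
  have bounded: "\<forall>\<^sub>F n in sequentially. z n * sqrt (real n) \<le> pi / sqrt 6"
    using eventually_gt_at_top[of 0] by eventually_elim (simp add: z_eq)
  have "limsup (\<lambda>n. ereal (1 / sqrt (real n)) *
    log_prob (measure_pmf.prob (gap_uniform qs n (k n))
      (deviation_event qs n (k n) (z n) limit_shape_inf t0 \<epsilon>))) < 0"
  proof (rule limit_shape_large_deviations[OF scaling gap _ feasible bounded, where ?t0.0 = t0 and ?t1.0 = v
        and g = "\<lambda>t. 0" and shape_lim = "\<lambda>a s. 0"])
    show "continuous_on {t0..v} limit_shape_inf"
      using t0 by (intro continuous_at_imp_continuous_on ballI isCont_shape) auto
    show "limit_shape_inf t \<le> limit_shape_inf s" if "t0 \<le> s" "s \<le> t" for s t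
      using that t0 by (intro shape_antimono) auto
    show "0 \<le> limit_shape_inf t" if "t0 \<le> t" for t
      using that t0 shape_pos[of t] by simp
  qed (use t0 v \<epsilon> point gaps m_def in auto)
  then show ?thesis by (simp add: z_def)
qed

theorem theorem4p2:
  fixes qs :: "nat \<Rightarrow> nat" and q \<beta> :: real and k :: "nat \<Rightarrow> nat"
  assumes "gap_sequence qs"
    and "0 \<le> q" and "0 \<le> \<beta>" and "\<beta> < 1"
    and "(\<lambda>m. real (\<Sum>i<m. qs i) - q * real m) \<in> O(\<lambda>m. real m powr \<beta>)"
    and "\<And>n. 0 < k n"
    and "filterlim k at_top sequentially"
  shows "(\<forall>\<tau>::real. 0 < \<tau> \<and> (0 < q \<longrightarrow> \<tau> < sqrt (2 / q)) \<and>
            (\<lambda>n. real (k n) / sqrt (real n)) \<longlonglongrightarrow> \<tau> \<longrightarrow>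
          (\<exists>!T. 0 < T \<and> \<tau> * vartheta q T = T) \<and>
          (\<forall>T. 0 < T \<and> \<tau> * vartheta q T = T \<longrightarrow>
            (\<lambda>n. T / real (k n)) \<sim>[sequentially] (\<lambda>n. T / (\<tau> * sqrt (real n))) \<and>
            (\<forall>t0 > 0. \<forall>\<epsilon> > 0.
              limsup (\<lambda>n. ereal (1 / sqrt (real n)) *
                log_prob (measure_pmf.prob (gap_uniform qs n (k n))
                  (deviation_event qs n (k n) (T / real (k n)) (limit_shape q T) t0 \<epsilon>))) < 0)))
       \<and> (q = 0 \<and>
            filterlim (\<lambda>n. real (k n) / sqrt (real n)) at_top sequentially \<and>
            (\<exists>\<delta>. 0 < \<delta> \<and> \<delta> < 1 \<and>
              limsup (\<lambda>n. ereal (real (k n) powr (\<beta> + 1) / real n powr (1 - \<delta>))) < \<infinity>) \<longrightarrow>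
          (\<forall>t0 > 0. \<forall>\<epsilon> > 0.
            limsup (\<lambda>n. ereal (1 / sqrt (real n)) *
              log_prob (measure_pmf.prob (gap_uniform qs n (k n))
                (deviation_event qs n (k n) (pi / sqrt (6 * real n)) limit_shape_inf t0 \<epsilon>))) < 0))"
proof (intro conjI allI impI)
  fix \<tau> :: real
  assume "0 < \<tau> \<and> (0 < q \<longrightarrow> \<tau> < sqrt (2 / q)) \<and> (\<lambda>n. real (k n) / sqrt (real n)) \<longlonglongrightarrow> \<tau>"
  then have \<tau>: "0 < \<tau>" "0 < q \<longrightarrow> \<tau> < sqrt (2 / q)" "(\<lambda>n. real (k n) / sqrt (real n)) \<longlonglongrightarrow> \<tau>"
    by auto
  show "\<exists>!T. 0 < T \<and> \<tau> * vartheta q T = T" by (rule vartheta_fixed_point_ex1[OF \<tau>(1) assms(2) \<tau>(2)])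
  fix T assume "0 < T \<and> \<tau> * vartheta q T = T"
  then have T: "0 < T" "\<tau> * vartheta q T = T" by auto
  show "(\<lambda>n. T / real (k n)) \<sim>[sequentially] (\<lambda>n. T / (\<tau> * sqrt (real n)))"
  proof (rule asymp_equivI')
    have "(\<lambda>n. \<tau> / (real (k n) / sqrt (real n))) \<longlonglongrightarrow> \<tau> / \<tau>" using \<tau> by (intro tendsto_intros) auto
    then show "(\<lambda>n. T / real (k n) / (T / (\<tau> * sqrt (real n)))) \<longlonglongrightarrow> 1" using T \<tau> by simp
  qed
  show "limsup (\<lambda>n. ereal (1 / sqrt (real n)) *
      log_prob (measure_pmf.prob (gap_uniform qs n (k n))
        (deviation_event qs n (k n) (T / real (k n)) (limit_shape q T) t0 \<epsilon>))) < 0"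
    if "0 < t0" "0 < \<epsilon>" for t0 \<epsilon>
    by (rule sqrt_length_deviations[OF assms \<tau>(1,3) T that])
next
  fix t0 \<epsilon> :: real
  assume A: "q = 0 \<and> filterlim (\<lambda>n. real (k n) / sqrt (real n)) at_top sequentially \<and>
      (\<exists>\<delta>. 0 < \<delta> \<and> \<delta> < 1 \<and>
        limsup (\<lambda>n. ereal (real (k n) powr (\<beta> + 1) / real n powr (1 - \<delta>))) < \<infinity>)"
    and t0: "0 < t0" "0 < \<epsilon>"
  then obtain \<delta> where "0 < \<delta>"
    "limsup (\<lambda>n. ereal (real (k n) powr (\<beta> + 1) / real n powr (1 - \<delta>))) < \<infinity>" by blast
  moreover have "(\<lambda>m. real (\<Sum>i<m. qs i) - 0 * real m) \<in> O(\<lambda>m. real m powr \<beta>)"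
    using assms(5) A by simp
  ultimately show "limsup (\<lambda>n. ereal (1 / sqrt (real n)) *
      log_prob (measure_pmf.prob (gap_uniform qs n (k n))
        (deviation_event qs n (k n) (pi / sqrt (6 * real n)) limit_shape_inf t0 \<epsilon>))) < 0"
    using A t0 by (intro large_length_deviations[OF assms(1,3) _ assms(6)]) auto
qed

end
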